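(* For any orthonormal basis $\{|\psi_j\rangle_{AB}\}_{j=1}^{d_Ad_B}$ of $\mathcal H_A\otimes\mathcal H_B$ ($\dim\mathcal H_A=d_A$, $\dim\mathcal H_B=d_B$), $r_{min}(\{|\psi_j\rangle\})=d_{min}(\{|\psi_j\rangle\})$.
   Context: Alice holds $\mathcal H_A\otimes\mathcal H_{A'}$ and Bob holds $\mathcal H_B\otimes\mathcal H_{B'}$. A set of states $\{|\psi_j\rangle_{AB}\otimes|\Phi\rangle_{A'B'}\}_j$ is one-way LOCC distinguishable if there is a protocol in which Alice performs a measurement on $AA'$, sends its outcome to Bob, and Bob performs a measurement on $BB'$ depending on it, such that for each $j$ the final outcomes identify $j$ with certainty when the state is $|\psi_j\rangle\otimes|\Phi\rangle$. Define $r_{min}(\{|\psi_j\rangle\})$ as the minimum, over finite-dimensional $\mathcal H_{A'},\mathcal H_{B'}$ and states $|\Phi\rangle\in\mathcal H_{A'}\otimes\mathcal H_{B'}$ such that $\{|\psi_j\rangle\otimes|\Phi\rangle\}_j$ is one-way LOCC distinguishable, of the Schmidt rank of $|\Phi\rangle$ across $A'|B'$. Define $d_{min}(\{|\psi_j\rangle\})$ as the minimum, over orthogonal direct-sum decompositions $\mathcal H_A=\bigoplus_k\mathcal M_k$ such that for every $j$ there is $k$ with $|\psi_j\rangle\in\mathcal M_k\otimes\mathcal H_B$, of $\max_k\dim\mathcal M_k$. *)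

theory Defs
  imports Complex_Main
begin

text \<open>Concrete coordinates. A vector of C^n is a function nat => complex that vanishes
  outside the index range {..<n}. A vector of C^m (x) C^n is given by its coefficients
  (a function of two indices, only the indices in range being relevant).\<close>

definition vecs :: "nat \<Rightarrow> (nat \<Rightarrow> complex) set" where
  "vecs n = {v. \<forall>i\<ge>n. v i = 0}"

definition cinner :: "nat \<Rightarrow> (nat \<Rightarrow> complex) \<Rightarrow> (nat \<Rightarrow> complex) \<Rightarrow> complex" where
  "cinner n u v = (\<Sum>i<n. cnj (u i) * v i)"

definition csubspace :: "nat \<Rightarrow> (nat \<Rightarrow> complex) set \<Rightarrow> bool" where
  "csubspace n M \<longleftrightarrow> M \<subseteq> vecs n \<and> (\<lambda>_. 0) \<in> M \<and>
     (\<forall>u\<in>M. \<forall>v\<in>M. (\<lambda>i. u i + v i) \<in> M) \<and>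
     (\<forall>c u. u \<in> M \<longrightarrow> (\<lambda>i. c * u i) \<in> M)"

definition cindep :: "(nat \<Rightarrow> complex) set \<Rightarrow> bool" where
  "cindep S \<longleftrightarrow> finite S \<and>
     (\<forall>c. (\<forall>i. (\<Sum>v\<in>S. c v * v i) = 0) \<longrightarrow> (\<forall>v\<in>S. c v = 0))"

definition cdim :: "(nat \<Rightarrow> complex) set \<Rightarrow> nat" where
  "cdim M = Max {card S | S. S \<subseteq> M \<and> cindep S}"

definition orth_decomp :: "nat \<Rightarrow> nat \<Rightarrow> (nat \<Rightarrow> (nat \<Rightarrow> complex) set) \<Rightarrow> bool" where
  "orth_decomp n K M \<longleftrightarrow>
     (\<forall>k<K. csubspace n (M k)) \<and>
     (\<forall>k<K. \<forall>l<K. k \<noteq> l \<longrightarrow> (\<forall>u\<in>M k. \<forall>v\<in>M l. cinner n u v = 0)) \<and>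
     (\<forall>v\<in>vecs n. \<exists>u. (\<forall>k<K. u k \<in> M k) \<and> (\<forall>i. v i = (\<Sum>k<K. u k i)))"

definition in_tensor_sub :: "nat \<Rightarrow> nat \<Rightarrow> (nat \<Rightarrow> complex) set \<Rightarrow> (nat \<Rightarrow> nat \<Rightarrow> complex) \<Rightarrow> bool" where
  "in_tensor_sub dA dB M \<psi> \<longleftrightarrow>
     (\<exists>(r::nat) m w. (\<forall>t<r. m t \<in> M \<and> w t \<in> vecs dB) \<and>
        (\<forall>i<dA. \<forall>k<dB. \<psi> i k = (\<Sum>t<r. m t i * w t k)))"

definition is_state :: "nat \<Rightarrow> nat \<Rightarrow> (nat \<Rightarrow> nat \<Rightarrow> complex) \<Rightarrow> bool" where
  "is_state a b \<Phi> \<longleftrightarrow> (\<Sum>i<a. \<Sum>k<b. (cmod (\<Phi> i k))\<^sup>2) = 1"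

definition schmidt_decomp :: "nat \<Rightarrow> nat \<Rightarrow> (nat \<Rightarrow> nat \<Rightarrow> complex) \<Rightarrow> nat \<Rightarrow> bool" where
  "schmidt_decomp a b \<Phi> r \<longleftrightarrow>
     (\<exists>(sv::nat \<Rightarrow> real) u v.
        (\<forall>t<r. sv t > 0 \<and> u t \<in> vecs a \<and> v t \<in> vecs b) \<and>
        (\<forall>t<r. \<forall>s<r. cinner a (u t) (u s) = (if t = s then 1 else 0)) \<and>
        (\<forall>t<r. \<forall>s<r. cinner b (v t) (v s) = (if t = s then 1 else 0)) \<and>
        (\<forall>i<a. \<forall>k<b. \<Phi> i k = (\<Sum>t<r. complex_of_real (sv t) * u t i * v t k)))"

definition schmidt_rank :: "nat \<Rightarrow> nat \<Rightarrow> (nat \<Rightarrow> nat \<Rightarrow> complex) \<Rightarrow> nat" where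
  "schmidt_rank a b \<Phi> = (LEAST r. schmidt_decomp a b \<Phi> r)"

definition psd_on :: "'i set \<Rightarrow> ('i \<Rightarrow> 'i \<Rightarrow> complex) \<Rightarrow> bool" where
  "psd_on I E \<longleftrightarrow> (\<forall>v. Im (\<Sum>x\<in>I. \<Sum>y\<in>I. cnj (v x) * E x y * v y) = 0 \<and>
                         Re (\<Sum>x\<in>I. \<Sum>y\<in>I. cnj (v x) * E x y * v y) \<ge> 0)"

definition povm :: "'i set \<Rightarrow> nat \<Rightarrow> (nat \<Rightarrow> 'i \<Rightarrow> 'i \<Rightarrow> complex) \<Rightarrow> bool" where
  "povm I n E \<longleftrightarrow> (\<forall>x<n. psd_on I (E x)) \<and>
     (\<forall>p\<in>I. \<forall>q\<in>I. (\<Sum>x<n. E x p q) = (if p = q then 1 else 0))"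

text \<open>Probability of the joint outcome when Alice applies POVM element EA on A A' and Bob
  applies POVM element FB on B B' to the state Psi of A B A' B'
  (Psi i k i' k' is the coefficient of |i>_A |k>_B |i'>_A' |k'>_B').\<close>

definition outcome_prob ::
  "nat \<Rightarrow> nat \<Rightarrow> nat \<Rightarrow> nat \<Rightarrow> (nat \<Rightarrow> nat \<Rightarrow> nat \<Rightarrow> nat \<Rightarrow> complex)
   \<Rightarrow> (nat \<times> nat \<Rightarrow> nat \<times> nat \<Rightarrow> complex) \<Rightarrow> (nat \<times> nat \<Rightarrow> nat \<times> nat \<Rightarrow> complex) \<Rightarrow> complex" where
  "outcome_prob dA dB a b \<Psi> EA FB =
     (\<Sum>p\<in>{..<dA} \<times> {..<a}. \<Sum>q\<in>{..<dB} \<times> {..<b}.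
      \<Sum>p'\<in>{..<dA} \<times> {..<a}. \<Sum>q'\<in>{..<dB} \<times> {..<b}.
        cnj (\<Psi> (fst p) (fst q) (snd p) (snd q)) * EA p p' * FB q q' *
        \<Psi> (fst p') (fst q') (snd p') (snd q'))"

text \<open>One-way LOCC distinguishability (with certainty) of the N states psi_j (x) Phi,
  j < N, where Phi is a state of C^a (x) C^b: Alice measures a POVM EA on A A',
  sends her outcome x to Bob, who measures a POVM F x on B B'; the pair of outcomes (x,y)
  determines the guess g x y, which must equal j whenever (x,y) occurs with nonzero
  probability on psi_j (x) Phi.\<close>

definition one_way_locc_dist ::
  "nat \<Rightarrow> nat \<Rightarrow> nat \<Rightarrow> (nat \<Rightarrow> nat \<Rightarrow> nat \<Rightarrow> complex) \<Rightarrow> nat \<Rightarrow> nat \<Rightarrow> (nat \<Rightarrow> nat \<Rightarrow> complex) \<Rightarrow> bool" where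
  "one_way_locc_dist dA dB N \<psi> a b \<Phi> \<longleftrightarrow>
     (\<exists>(nA::nat) EA nB F (g :: nat \<Rightarrow> nat \<Rightarrow> nat).
        povm ({..<dA} \<times> {..<a}) nA EA \<and>
        (\<forall>x<nA. povm ({..<dB} \<times> {..<b}) (nB x) (F x)) \<and>
        (\<forall>j<N. \<forall>x<nA. \<forall>y<nB x. g x y \<noteq> j \<longrightarrow>
            outcome_prob dA dB a b (\<lambda>i k i' k'. \<psi> j i k * \<Phi> i' k') (EA x) (F x y) = 0))"

definition r_min :: "nat \<Rightarrow> nat \<Rightarrow> nat \<Rightarrow> (nat \<Rightarrow> nat \<Rightarrow> nat \<Rightarrow> complex) \<Rightarrow> nat" where
  "r_min dA dB N \<psi> = (LEAST r. \<exists>a b \<Phi>. is_state a b \<Phi> \<and>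
       one_way_locc_dist dA dB N \<psi> a b \<Phi> \<and> schmidt_rank a b \<Phi> = r)"

definition d_min :: "nat \<Rightarrow> nat \<Rightarrow> nat \<Rightarrow> (nat \<Rightarrow> nat \<Rightarrow> nat \<Rightarrow> complex) \<Rightarrow> nat" where
  "d_min dA dB N \<psi> = (LEAST d. \<exists>K M. orth_decomp dA K M \<and>
       (\<forall>j<N. \<exists>k<K. in_tensor_sub dA dB (M k) (\<psi> j)) \<and>
       Max (cdim ` M ` {..<K}) = d)"

definition orthonormal_family :: "nat \<Rightarrow> nat \<Rightarrow> nat \<Rightarrow> (nat \<Rightarrow> nat \<Rightarrow> nat \<Rightarrow> complex) \<Rightarrow> bool" where
  "orthonormal_family dA dB N \<psi> \<longleftrightarrow>
     (\<forall>j<N. \<forall>l<N. (\<Sum>i<dA. \<Sum>k<dB. cnj (\<psi> j i k) * \<psi> l i k) = (if j = l then 1 else 0))"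

end

theory Submission
  imports Defs "HOL-Analysis.Function_Topology" "HOL-Analysis.Topology_Euclidean_Space"
begin

text \<open>
  Let Alice's outcome be the rank-one effect \<open>|e\<rangle>\<langle>e|\<close>; any effect is a sum of such. Then Bob holds the
  (unnormalised) state \<open>(\<psi>\<^sub>j)\<^sup>T T\<close> with \<open>T = \<langle>e|\<Phi>\<rangle>\<close>, regarded as a \<open>d\<^sub>A \<times> b\<close> matrix, and he can identify \<open>j\<close> iff these
  states are pairwise orthogonal, that is, iff \<open>Q \<otimes> I\<close> is diagonal in the basis \<open>\<psi>\<close> for the Gram matrix \<open>Q\<close>
  of the rows of \<open>T\<close>.

  Given a protocol, every \<open>\<psi>\<^sub>j\<close> therefore lies in \<open>M \<otimes> H\<^sub>B\<close> for a joint eigenspace \<open>M\<close> of all the \<open>Q\<close>; since the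
  \<open>Q\<close> add up to \<open>I\<close> and have rank at most the Schmidt rank of \<open>\<Phi>\<close>, that rank bounds the dimension of every \<open>M\<close>. Conversely, given a
  decomposition into \<open>M\<^sub>k\<close> of dimension at most \<open>d\<close>, Alice measures \<open>k\<close> and teleports her part through a
  maximally entangled state of rank \<open>d\<close>: here all the \<open>Q\<close> are multiples of projections onto the \<open>M\<^sub>k\<close>.
\<close>

section \<open>Orthogonal families over a finite index set\<close>

text \<open>Orthogonality of Bob's states is forced by positivity: an effect with probability zero
  on a state annihilates that state, and each pair of outcomes rules out at least one of any two
  candidates, so every off-diagonal entry of every effect vanishes, and so does their sum, the inner
  product. The \<open>Q\<close> add up to the identity because Alice's effects do and the shared
  state has norm one. Their rank is bounded because T factors through the Schmidt decomposition of
  that state. In the converse direction the shared state is flat, so a Bell vector with its phases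
  and shifts leaves no trace in the Gram matrix beyond the projection itself. Neither construction
  preserves values exactly: each yields an object whose value is at most the given one, and this
  suffices for comparing two minima. The minima and maxima in the definitions are meaningful only
  for nonempty (and for \<open>Max\<close> also finite) sets, which is why existence and finiteness
  are proved along the way.\<close>

definition ip :: "'i set \<Rightarrow> ('i \<Rightarrow> complex) \<Rightarrow> ('i \<Rightarrow> complex) \<Rightarrow> complex" where
  "ip I u v = (\<Sum>x\<in>I. cnj (u x) * v x)"

definition nsq :: "'i set \<Rightarrow> ('i \<Rightarrow> complex) \<Rightarrow> real" where
  "nsq I v = (\<Sum>x\<in>I. (cmod (v x))\<^sup>2)"

lemma cinner_eq_ip: "cinner n = ip {..<n}"
  by (intro ext) (simp add: cinner_def ip_def)

lemma cmod_sq: "(complex_of_real (cmod z))\<^sup>2 = z * cnj z"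
  by (metis complex_norm_square of_real_power)

lemma cnj_ip: "cnj (ip I u v) = ip I v u"
  by (simp add: ip_def mult.commute)

lemma ip_self: "ip I v v = complex_of_real (nsq I v)"
  by (simp add: ip_def nsq_def cmod_sq mult.commute)

lemma nsq_nonneg: "0 \<le> nsq I v"
  by (simp add: nsq_def sum_nonneg)

lemma nsq_eq_0_iff: "finite I \<Longrightarrow> nsq I v = 0 \<longleftrightarrow> (\<forall>x\<in>I. v x = 0)"
  by (simp add: nsq_def sum_nonneg_eq_0_iff)

lemma ip_diff_right: "ip I u (\<lambda>x. v x - w x) = ip I u v - ip I u w"
  by (simp add: ip_def algebra_simps sum_subtractf)

lemma ip_diff_left: "ip I (\<lambda>x. v x - w x) u = ip I v u - ip I w u"
  by (simp add: ip_def algebra_simps sum_subtractf)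

lemma ip_scale_right: "ip I u (\<lambda>x. c * v x) = c * ip I u v"
  by (simp add: ip_def algebra_simps sum_distrib_left)

lemma ip_scale_left: "ip I (\<lambda>x. c * v x) u = cnj c * ip I v u"
  by (simp add: ip_def algebra_simps sum_distrib_left)

lemma ip_sum_right: "ip I u (\<lambda>x. \<Sum>j\<in>J. v j x) = (\<Sum>j\<in>J. ip I u (v j))"
  unfolding ip_def sum_distrib_left by (rule sum.swap)

lemma ip_sum_left: "ip I (\<lambda>x. \<Sum>j\<in>J. v j x) u = (\<Sum>j\<in>J. ip I (v j) u)"
  unfolding ip_def cnj_sum sum_distrib_right by (rule sum.swap)

lemma ip_cong: "(\<And>x. x \<in> I \<Longrightarrow> u x = u' x) \<Longrightarrow> (\<And>x. x \<in> I \<Longrightarrow> v x = v' x) \<Longrightarrow> ip I u v = ip I u' v'"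
  by (simp add: ip_def)

lemma ip_zero_if_self_zero:
  assumes "finite I" "ip I u u = 0" shows "ip I u v = 0" "ip I v u = 0"
proof -
  have "\<forall>x\<in>I. u x = 0" using assms by (simp add: ip_self nsq_eq_0_iff)
  then show "ip I u v = 0" "ip I v u = 0" by (simp_all add: ip_def)
qed

context
  fixes I :: "'i set" and J :: "'j set" and \<phi> :: "'j \<Rightarrow> 'i \<Rightarrow> complex" and v w
  assumes fin: "finite I" "finite J"
    and orth: "\<And>j l. j \<in> J \<Longrightarrow> l \<in> J \<Longrightarrow> j \<noteq> l \<Longrightarrow> ip I (\<phi> j) (\<phi> l) = 0"
  defines "w \<equiv> (\<lambda>x. v x - (\<Sum>j\<in>J. ip I (\<phi> j) v / ip I (\<phi> j) (\<phi> j) * \<phi> j x))"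
begin

text \<open>A vanishing \<open>\<phi> j\<close> is harmless here, since then the quotient is \<open>0 / 0 = 0\<close>.\<close>

lemma residual_orthogonal:
  assumes "l \<in> J" shows "ip I (\<phi> l) w = 0"
proof -
  have "ip I (\<phi> l) w = ip I (\<phi> l) v
      - (\<Sum>j\<in>J. ip I (\<phi> j) v / ip I (\<phi> j) (\<phi> j) * ip I (\<phi> l) (\<phi> j))"
    unfolding w_def ip_diff_right ip_sum_right ip_scale_right ..
  also have "(\<Sum>j\<in>J. ip I (\<phi> j) v / ip I (\<phi> j) (\<phi> j) * ip I (\<phi> l) (\<phi> j))
      = (\<Sum>j\<in>J. if j = l then ip I (\<phi> l) v / ip I (\<phi> l) (\<phi> l) * ip I (\<phi> l) (\<phi> l) else 0)"
    by (intro sum.cong) (use assms orth in auto)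
  also have "\<dots> = ip I (\<phi> l) v"
    using assms fin ip_zero_if_self_zero[of I "\<phi> l" v] by (cases "ip I (\<phi> l) (\<phi> l) = 0") auto
  finally show ?thesis by simp
qed

text \<open>The residual is orthogonal to everything subtracted from v, so its inner product with
  itself equals its inner product with v.\<close>

lemma residual_norm:
  "ip I w w = ip I v v - (\<Sum>j\<in>J. ip I v (\<phi> j) * ip I (\<phi> j) v / ip I (\<phi> j) (\<phi> j))"
proof -
  have "ip I w w = ip I v w
      - ip I (\<lambda>x. \<Sum>j\<in>J. ip I (\<phi> j) v / ip I (\<phi> j) (\<phi> j) * \<phi> j x) w"
    by (subst (1) w_def) (simp add: ip_diff_left)
  also have "ip I (\<lambda>x. \<Sum>j\<in>J. ip I (\<phi> j) v / ip I (\<phi> j) (\<phi> j) * \<phi> j x) w = 0"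
    unfolding ip_sum_left ip_scale_left by (simp add: residual_orthogonal)
  also have "ip I v w = ip I v v - (\<Sum>j\<in>J. ip I v (\<phi> j) * ip I (\<phi> j) v / ip I (\<phi> j) (\<phi> j))"
    unfolding w_def ip_diff_right ip_sum_right ip_scale_right by (simp add: mult.commute)
  finally show ?thesis by simp
qed

lemma bessel:
  "(\<Sum>j\<in>J. (cmod (ip I (\<phi> j) v))\<^sup>2 / nsq I (\<phi> j)) \<le> nsq I v"
proof -
  have "complex_of_real (nsq I w)
      = complex_of_real (nsq I v - (\<Sum>j\<in>J. (cmod (ip I (\<phi> j) v))\<^sup>2 / nsq I (\<phi> j)))"
    using residual_norm
    by (simp add: ip_self cmod_sq cnj_ip mult.commute)
  then have "nsq I w = nsq I v - (\<Sum>j\<in>J. (cmod (ip I (\<phi> j) v))\<^sup>2 / nsq I (\<phi> j))"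
    by (simp only: of_real_eq_iff)
  then show ?thesis using nsq_nonneg[of I w] by simp
qed

end

text \<open>Bessel's inequality for a family with a single member.\<close>

lemma cauchy_schwarz:
  assumes "finite I" shows "(cmod (ip I u v))\<^sup>2 \<le> nsq I u * nsq I v"
proof (cases "nsq I u = 0")
  case True
  then have "ip I u v = 0" using assms ip_zero_if_self_zero(1)[of I u v] by (simp add: ip_self)
  with True show ?thesis by simp
next
  case False
  then have "nsq I u > 0" using nsq_nonneg[of I u] by simp
  with bessel[of I "{()}" "\<lambda>_. u" v] assms show ?thesis by (simp add: field_simps)
qed

lemma orthonormal_bessel:
  assumes "finite I" "finite J"
    and on: "\<And>j l. j \<in> J \<Longrightarrow> l \<in> J \<Longrightarrow> ip I (\<phi> j) (\<phi> l) = (if j = l then 1 else 0)"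
  shows "(\<Sum>j\<in>J. (cmod (ip I (\<phi> j) v))\<^sup>2) \<le> nsq I v"
proof -
  have "nsq I (\<phi> j) = 1" if "j \<in> J" for j
    using on[OF that that] by (simp add: ip_self)
  then show ?thesis using bessel[of I J \<phi> v] assms by simp
qed

text \<open>Bessel's inequality for the standard basis vector at p, whose coefficients are the
  conjugated p-entries of the family.\<close>

lemma orthonormal_row_le_1:
  assumes "finite I" "finite J"
    and on: "\<And>j l. j \<in> J \<Longrightarrow> l \<in> J \<Longrightarrow> ip I (\<phi> j) (\<phi> l) = (if j = l then 1 else 0)"
    and "p \<in> I"
  shows "(\<Sum>j\<in>J. (cmod (\<phi> j p))\<^sup>2) \<le> 1"
proof -
  have "ip I (\<phi> j) (\<lambda>x. if x = p then 1 else 0) = cnj (\<phi> j p)" for j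
    using assms by (simp add: ip_def if_distrib [of "\<lambda>c. _ * c"] cong: if_cong)
  moreover have "nsq I (\<lambda>x. if x = p then 1 else 0) = 1"
  proof -
    have "nsq I (\<lambda>x. if x = p then 1 else 0) = (\<Sum>x\<in>I. if x = p then 1 else 0)"
      unfolding nsq_def by (intro sum.cong) auto
    then show ?thesis using assms by simp
  qed
  ultimately show ?thesis
    using orthonormal_bessel[OF assms(1,2) on, of "\<lambda>x. if x = p then 1 else 0"] by simp
qed

lemma orthonormal_total:
  assumes "finite J"
    and on: "\<And>j. j \<in> J \<Longrightarrow> ip I (\<phi> j) (\<phi> j) = 1"
  shows "(\<Sum>p\<in>I. \<Sum>j\<in>J. (cmod (\<phi> j p))\<^sup>2) = card J"
proof -
  have "nsq I (\<phi> j) = 1" if "j \<in> J" for j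
    using on[OF that] by (simp add: ip_self)
  then have "(\<Sum>j\<in>J. \<Sum>p\<in>I. (cmod (\<phi> j p))\<^sup>2) = card J" by (simp add: nsq_def)
  then show ?thesis by (subst sum.swap)
qed

text \<open>Double counting of all squared entries: every vector contributes 1, every row at most
  1.\<close>

lemma orthonormal_card_le:
  assumes "finite I" "finite J"
    and on: "\<And>j l. j \<in> J \<Longrightarrow> l \<in> J \<Longrightarrow> ip I (\<phi> j) (\<phi> l) = (if j = l then 1 else 0)"
  shows "card J \<le> card I"
proof -
  have "real (card J) = (\<Sum>p\<in>I. \<Sum>j\<in>J. (cmod (\<phi> j p))\<^sup>2)"
    using orthonormal_total[of J I \<phi>] assms by simp
  also have "\<dots> \<le> (\<Sum>p\<in>I. 1)"
    by (intro sum_mono orthonormal_row_le_1[OF assms])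
  finally show ?thesis by simp
qed

text \<open>The row sums of squares are at most \<open>1\<close> and add up to \<open>card I\<close>, so all of them equal \<open>1\<close>:
  Bessel's inequality is an equality on every standard basis vector.\<close>

lemma orthonormal_complete:
  assumes "finite I" "finite J" "card J = card I"
    and on: "\<And>j l. j \<in> J \<Longrightarrow> l \<in> J \<Longrightarrow> ip I (\<phi> j) (\<phi> l) = (if j = l then 1 else 0)"
    and "x \<in> I"
  shows "v x = (\<Sum>j\<in>J. ip I (\<phi> j) v * \<phi> j x)"
proof -
  have row: "(\<Sum>j\<in>J. (cmod (\<phi> j p))\<^sup>2) = 1" if "p \<in> I" for p
  proof (rule ccontr)
    assume "\<not> ?thesis"
    then have "(\<Sum>j\<in>J. (cmod (\<phi> j p))\<^sup>2) < 1"
      using orthonormal_row_le_1[OF assms(1,2) on that] by simp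
    then have "(\<Sum>p\<in>I. \<Sum>j\<in>J. (cmod (\<phi> j p))\<^sup>2) < (\<Sum>p\<in>I. 1)"
      using that by (intro sum_strict_mono_ex1 assms(1)
        ballI orthonormal_row_le_1[OF assms(1,2) on]) auto
    then show False using orthonormal_total[of J I \<phi>] assms by simp
  qed
  have delta: "(if x = p then 1 else 0) = (\<Sum>j\<in>J. cnj (\<phi> j p) * \<phi> j x)" if p: "p \<in> I" for p
  proof -
    define e :: "'a \<Rightarrow> complex" where "e = (\<lambda>x. if x = p then 1 else 0)"
    have ipe: "ip I u e = cnj (u p)" for u
      using assms p by (simp add: e_def ip_def if_distrib [of "\<lambda>c. _ * c"] cong: if_cong)
    have ipe': "ip I e u = u p" for u
      using ipe[of u] by (metis cnj_ip complex_cnj_cnj)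
    define w where "w = (\<lambda>x. e x - (\<Sum>j\<in>J. ip I (\<phi> j) e / ip I (\<phi> j) (\<phi> j) * \<phi> j x))"
    have "ip I w w = ip I e e - (\<Sum>j\<in>J. ip I e (\<phi> j) * ip I (\<phi> j) e / ip I (\<phi> j) (\<phi> j))"
      unfolding w_def by (rule residual_norm) (use assms in auto)
    also have "\<dots> = 1 - of_real (\<Sum>j\<in>J. (cmod (\<phi> j p))\<^sup>2)"
      using on unfolding ipe ipe' by (simp add: e_def cmod_sq mult.commute)
    finally have "nsq I w = 0" using row[OF p] by (simp add: ip_self)
    then have "w x = 0" using assms by (simp add: nsq_eq_0_iff)
    then show ?thesis using on unfolding w_def ipe by (simp add: e_def)
  qed
  have "v x = (\<Sum>p\<in>I. if x = p then v p else 0)"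
    using assms by simp
  also have "\<dots> = (\<Sum>p\<in>I. (if x = p then 1 else 0) * v p)" by (intro sum.cong) auto
  also have "\<dots> = (\<Sum>p\<in>I. \<Sum>j\<in>J. cnj (\<phi> j p) * v p * \<phi> j x)"
    using delta by (intro sum.cong refl) (simp add: sum_distrib_left mult_ac)
  also have "\<dots> = (\<Sum>j\<in>J. ip I (\<phi> j) v * \<phi> j x)"
    unfolding ip_def sum_distrib_right by (rule sum.swap)
  finally show ?thesis .
qed

section \<open>Sesquilinear forms and measurements\<close>

definition sesq :: "'i set \<Rightarrow> ('i \<Rightarrow> 'i \<Rightarrow> complex) \<Rightarrow> ('i \<Rightarrow> complex) \<Rightarrow> ('i \<Rightarrow> complex) \<Rightarrow> complex" where
  "sesq I E u v = (\<Sum>x\<in>I. \<Sum>y\<in>I. cnj (u x) * E x y * v y)"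

lemma sesq_insert:
  assumes "finite I" "p \<notin> I"
  shows "sesq (insert p I) E v v = sesq I E v v + cnj (v p) * E p p * v p
     + cnj (v p) * (\<Sum>y\<in>I. E p y * v y) + (\<Sum>x\<in>I. cnj (v x) * E x p) * v p"
  using assms
  by (simp add: sesq_def sum.distrib algebra_simps sum_distrib_left sum_distrib_right)

lemma sesq_rank_one:
  "sesq I (\<lambda>x y. e x * cnj (e y)) u v = ip I u e * ip I e v"
  unfolding sesq_def ip_def sum_product by (simp add: mult_ac)

lemma sesq_sum: "sesq I (\<lambda>x y. \<Sum>s\<in>S. E s x y) u v = (\<Sum>s\<in>S. sesq I (E s) u v)"
proof -
  have "sesq I (\<lambda>x y. \<Sum>s\<in>S. E s x y) u v = (\<Sum>x\<in>I. \<Sum>y\<in>I. \<Sum>s\<in>S. cnj (u x) * E s x y * v y)"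
    by (simp add: sesq_def sum_distrib_left sum_distrib_right)
  also have "\<dots> = (\<Sum>x\<in>I. \<Sum>s\<in>S. \<Sum>y\<in>I. cnj (u x) * E s x y * v y)"
    by (intro sum.cong refl sum.swap)
  also have "\<dots> = (\<Sum>s\<in>S. sesq I (E s) u v)"
    unfolding sesq_def by (rule sum.swap)
  finally show ?thesis .
qed

lemma sesq_cong:
  "(\<And>x y. x \<in> I \<Longrightarrow> y \<in> I \<Longrightarrow> E x y = E' x y) \<Longrightarrow> sesq I E u v = sesq I E' u v"
  unfolding sesq_def by (intro sum.cong refl) simp

lemma sesq_cong_vec:
  "(\<And>x. x \<in> I \<Longrightarrow> u x = u' x) \<Longrightarrow> (\<And>x. x \<in> I \<Longrightarrow> v x = v' x) \<Longrightarrow> sesq I E u v = sesq I E u' v'"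
  unfolding sesq_def by (intro sum.cong refl) simp

lemma sesq_id: "finite I \<Longrightarrow> sesq I (\<lambda>x y. if x = y then 1 else 0) u v = ip I u v"
  unfolding sesq_def ip_def
  by (intro sum.cong refl) (simp add: if_distrib[of "\<lambda>c. _ * c"] if_distrib[of "\<lambda>c. c * _"] cong: if_cong)

lemma psd_on_iff: "psd_on I E \<longleftrightarrow> (\<forall>v. sesq I E v v \<in> \<real> \<and> 0 \<le> Re (sesq I E v v))"
  by (simp add: psd_on_def sesq_def complex_is_Real_iff)

text \<open>\<open>psd_on\<close> speaks only about values of the quadratic form; vectors supported
  on two indices give access to single entries of the matrix.\<close>

lemma psd_pair:
  assumes "finite I" "psd_on I E" "x \<in> I" "y \<in> I" "x \<noteq> y"
  shows "Im (cnj \<alpha> * E x x * \<alpha> + cnj \<alpha> * E x y * \<beta> + cnj \<beta> * E y x * \<alpha> + cnj \<beta> * E y y * \<beta>) = 0"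
    and "0 \<le> Re (cnj \<alpha> * E x x * \<alpha> + cnj \<alpha> * E x y * \<beta> + cnj \<beta> * E y x * \<alpha> + cnj \<beta> * E y y * \<beta>)"
proof -
  define v where "v = (\<lambda>z. if z = x then \<alpha> else if z = y then \<beta> else 0)"
  have "sesq I E v v = (\<Sum>z\<in>{x,y}. \<Sum>w\<in>I. cnj (v z) * E z w * v w)"
    unfolding sesq_def using assms by (intro sum.mono_neutral_right) (auto simp: v_def)
  also have "\<dots> = (\<Sum>z\<in>{x,y}. \<Sum>w\<in>{x,y}. cnj (v z) * E z w * v w)"
    using assms by (intro sum.cong refl sum.mono_neutral_right) (auto simp: v_def)
  also have "\<dots> = cnj \<alpha> * E x x * \<alpha> + cnj \<alpha> * E x y * \<beta> + cnj \<beta> * E y x * \<alpha> + cnj \<beta> * E y y * \<beta>"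
    using assms by (simp add: v_def)
  finally have eq: "sesq I E v v
    = cnj \<alpha> * E x x * \<alpha> + cnj \<alpha> * E x y * \<beta> + cnj \<beta> * E y x * \<alpha> + cnj \<beta> * E y y * \<beta>" .
  show "Im (cnj \<alpha> * E x x * \<alpha> + cnj \<alpha> * E x y * \<beta> + cnj \<beta> * E y x * \<alpha> + cnj \<beta> * E y y * \<beta>) = 0"
    "0 \<le> Re (cnj \<alpha> * E x x * \<alpha> + cnj \<alpha> * E x y * \<beta> + cnj \<beta> * E y x * \<alpha> + cnj \<beta> * E y y * \<beta>)"
    using assms(2) unfolding eq[symmetric] psd_on_iff complex_is_Real_iff by blast+
qed

lemma psd_diag:
  assumes "finite I" "psd_on I E" "x \<in> I"
  shows "E x x \<in> \<real>" "0 \<le> Re (E x x)"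
proof -
  define v :: "'a \<Rightarrow> complex" where "v = (\<lambda>z. if z = x then 1 else 0)"
  have "sesq I E v v = (\<Sum>z\<in>{x}. \<Sum>w\<in>I. cnj (v z) * E z w * v w)"
    unfolding sesq_def using assms by (intro sum.mono_neutral_right) (auto simp: v_def)
  also have "\<dots> = (\<Sum>z\<in>{x}. \<Sum>w\<in>{x}. cnj (v z) * E z w * v w)"
    using assms by (intro sum.cong refl sum.mono_neutral_right) (auto simp: v_def)
  also have "\<dots> = E x x" by (simp add: v_def)
  finally show "E x x \<in> \<real>" "0 \<le> Re (E x x)" using assms(2) unfolding psd_on_iff by metis+
qed

lemma psd_hermitian:
  assumes "finite I" "psd_on I E" "x \<in> I" "y \<in> I"
  shows "E y x = cnj (E x y)"
proof (cases "x = y")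
  case True
  then show ?thesis using psd_diag(1)[OF assms(1,2,3)] by (simp add: complex_eq_iff complex_is_Real_iff)
next
  case False
  have "Im (E x x) = 0" "Im (E y y) = 0"
    using psd_diag(1)[OF assms(1,2)] assms(3,4) by (auto simp: complex_is_Real_iff)
  \<comment> \<open>Reality at (1, 1) cancels the imaginary part of \<open>E x y + E y x\<close>;
    reality at (1, \<i>) equates the real parts of the two entries.\<close>
  then show ?thesis
    using psd_pair(1)[OF assms False, of 1 1] psd_pair(1)[OF assms False, of 1 \<i>]
    by (simp add: complex_eq_iff)
qed

lemma psd_zero_diag:
  assumes "finite I" "psd_on I E" "x \<in> I" "y \<in> I" "E x x = 0"
  shows "E x y = 0"
proof (cases "x = y")
  case False
  have h: "E y x = cnj (E x y)" by (rule psd_hermitian[OF assms(1-4)])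
  show ?thesis
  proof (rule ccontr)
    assume nz: "E x y \<noteq> 0"
    \<comment> \<open>Chosen so that the form takes the value -1 at the vector with entries
      \<open>- t * E x y\<close> at x and 1 at y.\<close>
    define t where "t = (Re (E y y) + 1) / (2 * (cmod (E x y))\<^sup>2)"
    have sq: "(cmod (E x y))\<^sup>2 = Re (E x y) * Re (E x y) + Im (E x y) * Im (E x y)"
      using cmod_power2[of "E x y"] by (simp only: power2_eq_square)
    have "0 \<le> Re (E y y) - 2 * t * (cmod (E x y))\<^sup>2"
      using psd_pair(2)[OF assms(1-4) False, of "- of_real t * E x y" 1] assms(5)
      by (simp add: h sq algebra_simps)
    also have "2 * t * (cmod (E x y))\<^sup>2 = Re (E y y) + 1"
      using nz by (simp add: t_def)
    finally show False by simp
  qed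
qed (use assms in simp)

text \<open>One step of a Cholesky factorisation: split off the column of the new index \<open>p\<close>. The Schur
  complement stays positive because it is the form evaluated at the minimising \<open>p\<close>-entry.\<close>

lemma psd_rank_one_sum:
  assumes "finite I" "psd_on I E"
  shows "\<exists>(n::nat) e. \<forall>x\<in>I. \<forall>y\<in>I. E x y = (\<Sum>s<n. e s x * cnj (e s y))"
  using assms
proof (induction I arbitrary: E rule: finite_induct)
  case (insert p I)
  have fin: "finite (insert p I)" using insert by simp
  note herm = psd_hermitian[OF fin insert.prems]
  define c where "c = Re (E p p)"
  have c: "0 \<le> c" "E p p = of_real c"
    using psd_diag[OF fin insert.prems, of p] by (auto simp: c_def complex_eq_iff complex_is_Real_iff)
  \<comment> \<open>For \<open>c = 0\<close> the division makes \<open>e0\<close> zero, and by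
    \<open>psd_zero_diag\<close> the column to be split off is zero already.\<close>
  define e0 where "e0 = (\<lambda>x. E x p / of_real (sqrt c))"
  define E' where "E' = (\<lambda>x y. E x y - e0 x * cnj (e0 y))"
  have e0: "e0 x * cnj (e0 y) = E x p * E p y / of_real c"
    if "x \<in> insert p I" "y \<in> insert p I" for x y
  proof -
    have "complex_of_real (sqrt c) * complex_of_real (sqrt c) = of_real c"
      using c by (metis of_real_mult real_sqrt_mult_self abs_of_nonneg)
    then show ?thesis using herm[of y p] that by (simp add: e0_def)
  qed
  have E'p: "E' x p = 0" "E' p x = 0" if "x \<in> insert p I" for x
    using that e0[of x p] e0[of p x] c psd_zero_diag[OF fin insert.prems, of p x] herm[of p x]
    by (auto simp: E'_def)
  have "psd_on I E'"
    unfolding psd_on_iff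
  proof
    fix v
    define L where "L = (\<Sum>y\<in>I. E p y * v y)"
    define v' where "v' = v(p := - L / of_real c)"
    have L': "(\<Sum>x\<in>I. cnj (v x) * E x p) = cnj L"
      unfolding L_def cnj_sum
      by (intro sum.cong refl) (use herm[of p] in \<open>simp add: mult.commute\<close>)
    have v': "v' x = v x" if "x \<in> I" for x
      using that insert.hyps by (auto simp: v'_def)
    have on_I: "sesq I E v' v' = sesq I E v v" "(\<Sum>y\<in>I. E p y * v' y) = L"
      "(\<Sum>x\<in>I. cnj (v' x) * E x p) = cnj L"
      using v' by (auto simp: L'[symmetric], auto simp: L_def intro!: sesq_cong_vec)
    have "sesq (insert p I) E v' v' = sesq I E v v - cnj L * L / of_real c"
      unfolding sesq_insert[OF insert.hyps] on_I using c
      by (cases "c = 0") (simp_all add: v'_def)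
    also have "\<dots> = sesq I E' v v"
    proof -
      have "sesq I E' v v = sesq I E v v - sesq I (\<lambda>x y. e0 x * cnj (e0 y)) v v"
        by (simp add: sesq_def E'_def algebra_simps sum_subtractf)
      also have "sesq I (\<lambda>x y. e0 x * cnj (e0 y)) v v = sesq I (\<lambda>x y. E x p * E p y / of_real c) v v"
        using e0 by (intro sesq_cong) auto
      also have "\<dots> = (\<Sum>x\<in>I. cnj (v x) * E x p) * L / of_real c"
        unfolding sesq_def L_def sum_product sum_divide_distrib by (simp add: mult_ac)
      finally show ?thesis by (simp add: L')
    qed
    finally show "sesq I E' v v \<in> \<real> \<and> 0 \<le> Re (sesq I E' v v)"
      using insert.prems unfolding psd_on_iff by metis
  qed
  then obtain n :: nat and e where e: "\<And>x y. x \<in> I \<Longrightarrow> y \<in> I \<Longrightarrow> E' x y = (\<Sum>s<n. e s x * cnj (e s y))"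
    using insert.IH by metis
  \<comment> \<open>The vectors obtained for I say nothing about p; their entry there is set to 0
    because row and column p of \<open>E'\<close> vanish.\<close>
  define f where "f = (\<lambda>s. if s = n then e0 else (e s)(p := 0))"
  have "E x y = (\<Sum>s<Suc n. f s x * cnj (f s y))" if "x \<in> insert p I" "y \<in> insert p I" for x y
  proof -
    have "E' x y = (\<Sum>s<n. f s x * cnj (f s y))"
    proof (cases "x = p \<or> y = p")
      case True
      then have "E' x y = 0" using E'p that by auto
      with True show ?thesis by (auto simp: f_def)
    next
      case False
      then have "E' x y = (\<Sum>s<n. e s x * cnj (e s y))" using e that by auto
      also have "\<dots> = (\<Sum>s<n. f s x * cnj (f s y))"
        by (intro sum.cong refl) (use False in \<open>auto simp: f_def\<close>)
      finally show ?thesis .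
    qed
    then show ?thesis by (simp add: E'_def f_def algebra_simps)
  qed
  then show ?case by blast
qed simp

text \<open>In a rank-one expansion the form at v is a sum of squares \<open>|<e s, v>|^2\<close>;
  if it is zero, v is orthogonal to every \<open>e s\<close> and hence in the kernel.\<close>

lemma psd_null:
  assumes "finite I" "psd_on I E" "sesq I E v v = 0"
  shows "sesq I E u v = 0" "sesq I E v u = 0"
proof -
  obtain n :: nat and e where e: "\<And>x y. x \<in> I \<Longrightarrow> y \<in> I \<Longrightarrow> E x y = (\<Sum>s<n. e s x * cnj (e s y))"
    using psd_rank_one_sum[OF assms(1,2)] by metis
  have eq: "sesq I E u w = (\<Sum>s<n. ip I u (e s) * ip I (e s) w)" for u w
  proof -
    have "sesq I E u w = sesq I (\<lambda>x y. \<Sum>s<n. e s x * cnj (e s y)) u w"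
      by (rule sesq_cong) (rule e)
    then show ?thesis by (simp add: sesq_sum sesq_rank_one)
  qed
  have "of_real (\<Sum>s<n. (cmod (ip I (e s) v))\<^sup>2) = sesq I E v v"
    unfolding eq by (simp add: cmod_sq cnj_ip mult.commute)
  then have "(\<Sum>s<n. (cmod (ip I (e s) v))\<^sup>2) = 0"
    using assms(3) by (simp only: of_real_eq_0_iff)
  then have "\<forall>s<n. ip I (e s) v = 0" by (simp add: sum_nonneg_eq_0_iff)
  moreover from this have "\<forall>s<n. ip I v (e s) = 0" by (metis cnj_ip complex_cnj_zero)
  ultimately show "sesq I E u v = 0" "sesq I E v u = 0" unfolding eq by simp_all
qed

lemma psd_rank_one: "psd_on I (\<lambda>x y. e x * cnj (e y))"
proof -
  have "ip I v e * ip I e v = of_real ((cmod (ip I e v))\<^sup>2)" for v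
    by (simp add: cmod_sq cnj_ip mult.commute)
  then show ?thesis unfolding psd_on_iff sesq_rank_one by simp
qed

text \<open>Measure in the direction of each \<open>\<phi> y\<close>, with one further outcome for the orthogonal complement;
  again \<open>0 / 0 = 0\<close> takes care of vanishing \<open>\<phi> y\<close>.\<close>

lemma orthogonal_measurement:
  fixes \<phi> :: "nat \<Rightarrow> 'i \<Rightarrow> complex"
  assumes fin: "finite I"
    and orth: "\<And>j l. j < N \<Longrightarrow> l < N \<Longrightarrow> j \<noteq> l \<Longrightarrow> ip I (\<phi> j) (\<phi> l) = 0"
  shows "\<exists>F. povm I (Suc N) F \<and>
    (\<forall>j<N. \<forall>y<Suc N. y \<noteq> j \<longrightarrow> sesq I (F y) (\<phi> j) (\<phi> j) = 0)"
proof -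
  define G where "G = (\<lambda>y p q. \<phi> y p * cnj (\<phi> y q) / ip I (\<phi> y) (\<phi> y))"
  define F where "F = (\<lambda>y p q. if y < N then G y p q else (if p = q then 1 else 0) - (\<Sum>z<N. G z p q))"
  have sesq_G: "sesq I (G y) u v = ip I u (\<phi> y) * ip I (\<phi> y) v / ip I (\<phi> y) (\<phi> y)" for y u v
  proof -
    have "sesq I (G y) u v = sesq I (\<lambda>p q. \<phi> y p * cnj (\<phi> y q)) u v / ip I (\<phi> y) (\<phi> y)"
      by (simp add: sesq_def G_def sum_divide_distrib)
    then show ?thesis by (simp add: sesq_rank_one)
  qed
  have sesq_last: "sesq I (F N) v v = ip I v v - (\<Sum>y<N. ip I v (\<phi> y) * ip I (\<phi> y) v / ip I (\<phi> y) (\<phi> y))" for v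
  proof -
    have "sesq I (F N) v v = sesq I (\<lambda>p q. if p = q then 1 else 0) v v - sesq I (\<lambda>p q. \<Sum>z<N. G z p q) v v"
      by (simp add: F_def sesq_def algebra_simps sum_subtractf)
    then show ?thesis by (simp add: sesq_id fin sesq_sum sesq_G)
  qed
  have real: "ip I v (\<phi> y) * ip I (\<phi> y) v / ip I (\<phi> y) (\<phi> y)
      = of_real ((cmod (ip I (\<phi> y) v))\<^sup>2 / nsq I (\<phi> y))" for v y
    by (simp add: ip_self cmod_sq cnj_ip mult.commute)
  have "psd_on I (F y)" if "y < Suc N" for y
  proof (cases "y < N")
    case True
    then have "F y = G y" by (simp add: F_def fun_eq_iff)
    then show ?thesis by (simp only: psd_on_iff sesq_G real) (simp add: nsq_nonneg)
  next
    case False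
    then have "y = N" using that by simp
    moreover have "psd_on I (F N)"
      unfolding psd_on_iff
    proof
      fix v
      \<comment> \<open>The effect of the extra outcome projects onto the orthogonal complement, so
        its form is the squared norm of the residual of v.\<close>
      have "sesq I (F N) v v = of_real (nsq I (\<lambda>x. v x - (\<Sum>j\<in>{..<N}. ip I (\<phi> j) v / ip I (\<phi> j) (\<phi> j) * \<phi> j x)))"
        unfolding sesq_last ip_self[of I "\<lambda>x. v x - _ x", symmetric]
        by (rule residual_norm[symmetric]) (use fin orth in auto)
      then show "sesq I (F N) v v \<in> \<real> \<and> 0 \<le> Re (sesq I (F N) v v)" by (simp add: nsq_nonneg)
    qed
    ultimately show ?thesis by simp
  qed
  moreover have "(\<Sum>y<Suc N. F y p q) = (if p = q then 1 else 0)" for p q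
    by (simp add: F_def)
  moreover have "sesq I (F y) (\<phi> j) (\<phi> j) = 0" if "j < N" "y < Suc N" "y \<noteq> j" for j y
  proof (cases "y < N")
    case True
    then have "F y = G y" by (simp add: F_def fun_eq_iff)
    then show ?thesis using orth that True by (simp add: sesq_G)
  next
    case False
    then have "y = N" using that by simp
    \<comment> \<open>The vector \<open>\<phi> j\<close> is its own expansion, so the extra outcome
      never occurs on it.\<close>
    have "(\<Sum>y<N. ip I (\<phi> j) (\<phi> y) * ip I (\<phi> y) (\<phi> j) / ip I (\<phi> y) (\<phi> y))
       = (\<Sum>y<N. if y = j then ip I (\<phi> j) (\<phi> j) else 0)"
      by (intro sum.cong refl) (use orth that in auto)
    then show ?thesis using that unfolding \<open>y = N\<close> sesq_last by simp
  qed
  ultimately show ?thesis unfolding povm_def by blast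
qed

section \<open>Dimension and orthonormal bases\<close>

text \<open>Gaussian elimination: the last equation is solved for a pivot unknown p, which leaves
  one equation and one unknown less.\<close>

lemma homogeneous_system:
  assumes "finite S" "r < card S"
  shows "\<exists>c. (\<exists>v\<in>S. c v \<noteq> 0) \<and> (\<forall>t<r. (\<Sum>v\<in>S. c v * (A v t :: complex)) = 0)"
  using assms
proof (induction r arbitrary: S A)
  case 0
  then have "S \<noteq> {}" by auto
  then show ?case by (auto intro!: exI[of _ "\<lambda>_. 1"])
next
  case (Suc r)
  show ?case
  proof (cases "\<forall>v\<in>S. A v r = 0")
    case True
    obtain c where "\<exists>v\<in>S. c v \<noteq> 0" "\<forall>t<r. (\<Sum>v\<in>S. c v * A v t) = 0"
      using Suc.IH[of S A] Suc.prems by auto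
    with True show ?thesis by (intro exI[of _ c]) (auto simp: less_Suc_eq)
  next
    case False
    then obtain p where p: "p \<in> S" "A p r \<noteq> 0" by blast
    define B where "B = (\<lambda>v t. A v t - A v r / A p r * A p t)"
    have "r < card (S - {p})" using Suc.prems p by simp
    then obtain c where c: "\<exists>v\<in>S-{p}. c v \<noteq> 0" "\<forall>t<r. (\<Sum>v\<in>S-{p}. c v * B v t) = 0"
      using Suc.IH[of "S - {p}" B] Suc.prems by auto
    define c' where "c' = c(p := - (\<Sum>v\<in>S-{p}. c v * (A v r / A p r)))"
    have eq: "(\<Sum>v\<in>S. c' v * A v t) = (\<Sum>v\<in>S-{p}. c v * B v t)" for t
    proof -
      have "(\<Sum>v\<in>S. c' v * A v t) = c' p * A p t + (\<Sum>v\<in>S-{p}. c' v * A v t)"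
        using p Suc.prems by (simp add: sum.remove)
      also have "(\<Sum>v\<in>S-{p}. c' v * A v t) = (\<Sum>v\<in>S-{p}. c v * A v t)"
        by (intro sum.cong) (auto simp: c'_def)
      finally show ?thesis
        by (simp add: B_def c'_def algebra_simps sum_subtractf sum_distrib_left)
    qed
    have "(\<Sum>v\<in>S. c' v * A v t) = 0" if "t < Suc r" for t
      using that c(2) p unfolding eq by (cases "t = r") (auto simp: B_def)
    moreover have "\<exists>v\<in>S. c' v \<noteq> 0" using c(1) by (auto simp: c'_def)
    ultimately show ?thesis by blast
  qed
qed

text \<open>With more than r vectors, their coefficient vectors of length r satisfy a nontrivial
  linear relation, and the vectors themselves inherit it.\<close>

lemma cindep_card_le:
  assumes "cindep S" and sp: "\<And>v i. v \<in> S \<Longrightarrow> v i = (\<Sum>t<r. \<alpha> v t * w t i)"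
  shows "card S \<le> r"
proof (rule ccontr)
  assume "\<not> ?thesis"
  moreover have "finite S" using assms by (simp add: cindep_def)
  ultimately obtain c where c: "\<exists>v\<in>S. c v \<noteq> 0" "\<forall>t<r. (\<Sum>v\<in>S. c v * \<alpha> v t) = 0"
    using homogeneous_system[of S r \<alpha>] by auto
  have "(\<Sum>v\<in>S. c v * v i) = 0" for i
  proof -
    have "(\<Sum>v\<in>S. c v * v i) = (\<Sum>v\<in>S. \<Sum>t<r. c v * \<alpha> v t * w t i)"
    proof (rule sum.cong)
      fix v assume "v \<in> S"
      show "c v * v i = (\<Sum>t<r. c v * \<alpha> v t * w t i)"
        by (subst sp[OF \<open>v \<in> S\<close>]) (simp add: sum_distrib_left mult.assoc)
    qed simp
    also have "\<dots> = (\<Sum>t<r. (\<Sum>v\<in>S. c v * \<alpha> v t) * w t i)"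
      unfolding sum_distrib_right by (rule sum.swap)
    finally show ?thesis using c(2) by simp
  qed
  then show False using assms(1) c(1) by (auto simp: cindep_def)
qed

lemma cindep_empty: "cindep {}"
  by (simp add: cindep_def)

lemma cindep_vecs_card_le:
  assumes "cindep S" "S \<subseteq> vecs n" shows "card S \<le> n"
proof (rule cindep_card_le[OF assms(1), where \<alpha> = "\<lambda>v. v" and w = "\<lambda>t i. if i = t then 1 else 0"])
  fix v i assume "v \<in> S"
  then show "v i = (\<Sum>t<n. v t * (if i = t then 1 else 0))"
    using assms by (auto simp: vecs_def if_distrib[of "\<lambda>c. _ * c"] cong: if_cong)
qed

text \<open>The uniform bound also makes the set of cardinalities finite, so that its
  \<open>Max\<close> is attained; the empty set shows that it is nonempty.\<close>

lemma cdim_le: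
  assumes "\<And>S. S \<subseteq> M \<Longrightarrow> cindep S \<Longrightarrow> card S \<le> r"
  shows "cdim M \<le> r"
proof -
  have sub: "{card S | S. S \<subseteq> M \<and> cindep S} \<subseteq> {..r}"
    using assms by blast
  then have "finite {card S | S. S \<subseteq> M \<and> cindep S}"
    using finite_subset by blast
  moreover have "{card S | S. S \<subseteq> M \<and> cindep S} \<noteq> {}"
    using cindep_empty by blast
  ultimately show ?thesis unfolding cdim_def using sub by (metis (no_types, lifting) Max_in atMost_iff subsetD)
qed

lemma card_le_cdim:
  assumes "M \<subseteq> vecs n" "S \<subseteq> M" "cindep S"
  shows "card S \<le> cdim M"
proof -
  have "{card S | S. S \<subseteq> M \<and> cindep S} \<subseteq> {..n}"
    using assms(1) cindep_vecs_card_le by blast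
  then have "finite {card S | S. S \<subseteq> M \<and> cindep S}"
    using finite_subset by blast
  then show ?thesis unfolding cdim_def by (rule Max_ge) (use assms in blast)
qed

lemma orthonormal_cindep:
  assumes on: "\<And>s t. s < r \<Longrightarrow> t < r \<Longrightarrow> ip I (m s) (m t) = (if s = t then 1 else 0)"
  shows "cindep (m ` {..<r})" "card (m ` {..<r}) = r"
proof -
  \<comment> \<open>\<open>cindep\<close> is about sets, so a family with repetitions would be
    counted wrongly; orthonormality excludes repetitions.\<close>
  have inj: "inj_on m {..<r}"
    by (rule inj_onI) (metis on lessThan_iff zero_neq_one)
  then show "card (m ` {..<r}) = r" by (simp add: card_image)
  have "c (m s) = 0" if z: "\<forall>i. (\<Sum>v\<in>m ` {..<r}. c v * v i) = 0" and s: "s < r" for c s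
  proof -
    have "0 = ip I (m s) (\<lambda>i. \<Sum>t<r. c (m t) * m t i)"
      using z by (simp add: sum.reindex[OF inj] ip_def)
    also have "\<dots> = (\<Sum>t<r. c (m t) * ip I (m s) (m t))"
      unfolding ip_sum_right ip_scale_right ..
    also have "\<dots> = (\<Sum>t<r. if t = s then c (m s) else 0)"
      by (intro sum.cong) (use on s in auto)
    finally show ?thesis using s by simp
  qed
  then show "cindep (m ` {..<r})" by (auto simp: cindep_def)
qed

lemma csubspace_sum:
  assumes "csubspace n M" "finite J" "\<And>j. j \<in> J \<Longrightarrow> v j \<in> M"
  shows "(\<lambda>i. \<Sum>j\<in>J. v j i) \<in> M"
  using assms(2,3)
proof (induction J rule: finite_induct)
  case empty
  then show ?case using assms(1) by (simp add: csubspace_def)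
next
  case (insert j J)
  then show ?case using assms(1) by (auto simp: csubspace_def)
qed

lemma csubspace_scale: "csubspace n M \<Longrightarrow> v \<in> M \<Longrightarrow> (\<lambda>i. c * v i) \<in> M"
  by (simp add: csubspace_def)

lemma csubspace_add: "csubspace n M \<Longrightarrow> u \<in> M \<Longrightarrow> v \<in> M \<Longrightarrow> (\<lambda>i. u i + v i) \<in> M"
  by (simp add: csubspace_def)

lemma csubspace_diff:
  assumes "csubspace n M" "u \<in> M" "v \<in> M" shows "(\<lambda>i. u i - v i) \<in> M"
  using csubspace_add[OF assms(1,2) csubspace_scale[OF assms(1,3), of "-1"]] by simp

lemma nsq_normalise:
  assumes "nsq I w \<noteq> 0" shows "ip I (\<lambda>x. w x / of_real (sqrt (nsq I w))) (\<lambda>x. w x / of_real (sqrt (nsq I w))) = 1"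
proof -
  have "complex_of_real (sqrt (nsq I w)) * complex_of_real (sqrt (nsq I w)) = of_real (nsq I w)"
    using nsq_nonneg[of I w] by (simp flip: of_real_mult)
  then have "ip I (\<lambda>x. w x / of_real (sqrt (nsq I w))) (\<lambda>x. w x / of_real (sqrt (nsq I w)))
      = ip I w w / of_real (nsq I w)"
    by (simp add: ip_def sum_divide_distrib)
  then show ?thesis using assms by (simp add: ip_self)
qed

text \<open>An orthonormal family in M of maximal length, which exists because its length is bounded
  by \<open>cdim M\<close>. If some v in M were not recovered from its coefficients, the normalised
  residual would lie in M and extend the family.\<close>

lemma orthonormal_basis_exists:
  assumes M: "csubspace n M"
  shows "\<exists>(r::nat) m. r \<le> cdim M \<and> (\<forall>t<r. m t \<in> M)
    \<and> (\<forall>s<r. \<forall>t<r. ip {..<n} (m s) (m t) = (if s = t then 1 else 0))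
    \<and> (\<forall>v\<in>M. \<forall>i<n. v i = (\<Sum>t<r. ip {..<n} (m t) v * m t i))"
proof -
  define P where "P = (\<lambda>r::nat. \<exists>m. (\<forall>t<r. m t \<in> M)
    \<and> (\<forall>s<r. \<forall>t<r. ip {..<n} (m s) (m t) = (if s = t then 1 else 0)))"
  have le: "r \<le> cdim M" if Pr: "P r" for r
  proof -
    from Pr obtain m where m: "\<And>t. t < r \<Longrightarrow> m t \<in> M"
      "\<And>s t. s < r \<Longrightarrow> t < r \<Longrightarrow> ip {..<n} (m s) (m t) = (if s = t then 1 else 0)"
      unfolding P_def by metis
    have "card (m ` {..<r}) \<le> cdim M"
      by (rule card_le_cdim[of _ n]) (use M m orthonormal_cindep(1)[of r "{..<n}" m] in \<open>auto simp: csubspace_def\<close>)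
    then show ?thesis using orthonormal_cindep(2)[of r "{..<n}" m] m by simp
  qed
  have "P 0" by (simp add: P_def)
  define r where "r = Greatest P"
  have r: "P r" "\<And>r'. P r' \<Longrightarrow> r' \<le> r"
    unfolding r_def using GreatestI_nat[of P 0 "cdim M"] Greatest_le_nat[of P _ "cdim M"] \<open>P 0\<close> le
    by simp_all
  from r(1) obtain m where m: "\<And>t. t < r \<Longrightarrow> m t \<in> M"
      and on: "\<And>s t. s < r \<Longrightarrow> t < r \<Longrightarrow> ip {..<n} (m s) (m t) = (if s = t then 1 else 0)"
    unfolding P_def by metis
  have "v i = (\<Sum>t<r. ip {..<n} (m t) v * m t i)" if v: "v \<in> M" and "i < n" for v i
  proof (rule ccontr)
    assume neq: "\<not> ?thesis"
    define w where "w = (\<lambda>x. v x - (\<Sum>t\<in>{..<r}. ip {..<n} (m t) v / ip {..<n} (m t) (m t) * m t x))"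
    have w_eq: "w = (\<lambda>x. v x - (\<Sum>t<r. ip {..<n} (m t) v * m t x))"
      unfolding w_def using on by (intro ext arg_cong2[of _ _ _ _ "(-)"] sum.cong) auto
    have "w \<in> M"
      unfolding w_eq using m v by (intro csubspace_diff[OF M] csubspace_sum[OF M] csubspace_scale[OF M]) auto
    have orth: "ip {..<n} (m t) w = 0" if "t < r" for t
      unfolding w_def by (rule residual_orthogonal) (use on that in auto)
    have nz: "nsq {..<n} w \<noteq> 0" using neq \<open>i < n\<close> by (auto simp: nsq_eq_0_iff w_eq)
    define u where "u = (\<lambda>x. 1 / of_real (sqrt (nsq {..<n} w)) * w x)"
    have u: "u \<in> M" unfolding u_def by (rule csubspace_scale[OF M \<open>w \<in> M\<close>])
    have uu: "ip {..<n} u u = 1" using nsq_normalise[OF nz] by (simp add: u_def)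
    have mu: "ip {..<n} (m t) u = 0" if "t < r" for t
      unfolding u_def ip_scale_right using orth[OF that] by simp
    then have um: "ip {..<n} u (m t) = 0" if "t < r" for t
      using that cnj_ip[of "{..<n}" "m t" u] by simp
    have "P (Suc r)"
      unfolding P_def
      by (intro exI[of _ "m(r := u)"]) (auto simp: less_Suc_eq m u uu mu um on)
    then show False using r(2)[of "Suc r"] by simp
  qed
  with m on le[OF r(1)] show ?thesis by blast
qed

section \<open>Schmidt decompositions\<close>

text \<open>Vectors are functions on all of nat, so compactness comes from Tychonoff: the set is a
  product of closed discs and, from index n on, of singletons.\<close>

lemma compact_cube: "compact {v :: nat \<Rightarrow> complex. (\<forall>i<n. cmod (v i) \<le> 1) \<and> (\<forall>i\<ge>n. v i = 0)}"
proof -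
  define T :: "nat \<Rightarrow> complex set" where "T = (\<lambda>i. if i < n then cball (0::complex) 1 else {0})"
  have "compactin (product_topology (\<lambda>_::nat. euclidean) UNIV) (PiE UNIV T)"
    unfolding compactin_PiE by (auto simp: T_def)
  then have "compact (PiE UNIV T)" by (simp add: euclidean_product_topology)
  moreover have "PiE UNIV T = {v. (\<forall>i<n. cmod (v i) \<le> 1) \<and> (\<forall>i\<ge>n. v i = 0)}"
  proof -
    have "v i \<in> T i \<longleftrightarrow> (i < n \<longrightarrow> cmod (v i) \<le> 1) \<and> (i \<ge> n \<longrightarrow> v i = 0)" for v i
      by (simp add: T_def)
    then have "v \<in> PiE UNIV T \<longleftrightarrow> (\<forall>i<n. cmod (v i) \<le> 1) \<and> (\<forall>i\<ge>n. v i = 0)" for v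
      by (simp add: PiE_iff) blast
    then show ?thesis by (intro set_eqI) (simp only: mem_Collect_eq)
  qed
  ultimately show ?thesis by (simp only:)
qed

lemma compact_sphere: "compact {v \<in> vecs n. nsq {..<n} v = 1}"
proof -
  have cont: "continuous_on UNIV (nsq {..<n})"
    unfolding nsq_def by (intro continuous_intros) simp
  have "closed {v. nsq {..<n} v = 1}"
    using closed_vimage[of "{1}" "nsq {..<n}"] cont by (simp add: vimage_def)
  then have "compact ({v :: nat \<Rightarrow> complex. (\<forall>i<n. cmod (v i) \<le> 1) \<and> (\<forall>i\<ge>n. v i = 0)} \<inter> {v. nsq {..<n} v = 1})"
    by (rule compact_Int_closed[OF compact_cube])
  moreover have "cmod (v i) \<le> 1" if "nsq {..<n} v = 1" "i < n" for v i
  proof -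
    have "(cmod (v i))\<^sup>2 \<le> nsq {..<n} v"
      unfolding nsq_def using that by (intro member_le_sum) auto
    then show ?thesis using that by (simp add: power_le_one_iff abs_square_le_1)
  qed
  then have "{v :: nat \<Rightarrow> complex. (\<forall>i<n. cmod (v i) \<le> 1) \<and> (\<forall>i\<ge>n. v i = 0)} \<inter> {v. nsq {..<n} v = 1}
     = {v \<in> vecs n. nsq {..<n} v = 1}"
    by (auto simp: vecs_def)
  ultimately show ?thesis by simp
qed

text \<open>A maximiser \<open>v\<close> of \<open>\<parallel>\<Phi> v\<parallel>\<close> on the unit sphere is a right singular vector: with
  \<open>\<Phi> v = s u\<close>, both \<open>\<langle>v, \<Phi>\<^sup>* u\<rangle> = s\<close> and \<open>\<parallel>\<Phi>\<^sup>* u\<parallel> \<le> s\<close> hold, which forces \<open>\<Phi>\<^sup>* u = s v\<close>.\<close>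

lemma singular_pair_exists:
  assumes nz: "i0 < a" "k0 < b" "\<Phi> i0 k0 \<noteq> 0"
  shows "\<exists>(s::real) u v. s > 0 \<and> u \<in> vecs a \<and> v \<in> vecs b \<and> ip {..<a} u u = 1 \<and> ip {..<b} v v = 1 \<and>
    (\<forall>i<a. (\<Sum>k<b. \<Phi> i k * v k) = of_real s * u i) \<and>
    (\<forall>k<b. (\<Sum>i<a. cnj (u i) * \<Phi> i k) = of_real s * cnj (v k))"
proof -
  define A where "A = (\<lambda>v i. \<Sum>k<b. \<Phi> i k * v k)"
  have A_scale: "A (\<lambda>k. c * v k) = (\<lambda>i. c * A v i)" for c v
    by (simp add: A_def sum_distrib_left mult_ac)
  define C where "C = {v \<in> vecs b. nsq {..<b} v = 1}"
  define e :: "nat \<Rightarrow> complex" where "e = (\<lambda>k. if k = k0 then 1 else 0)"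
  have e: "e \<in> C" "A e i0 = \<Phi> i0 k0"
  proof -
    have "nsq {..<b} e = (\<Sum>k<b. if k = k0 then 1 else 0)"
      unfolding nsq_def by (intro sum.cong) (auto simp: e_def)
    then show "e \<in> C" using nz by (auto simp: C_def vecs_def e_def)
    show "A e i0 = \<Phi> i0 k0"
      using nz by (simp add: A_def e_def if_distrib[of "\<lambda>c. _ * c"] cong: if_cong)
  qed
  have "continuous_on UNIV (\<lambda>v. nsq {..<a} (A v))"
    unfolding nsq_def A_def by (intro continuous_intros) simp
  then have cont: "continuous_on C (\<lambda>v. nsq {..<a} (A v))"
    by (rule continuous_on_subset) simp
  obtain v where v: "v \<in> C" "\<And>v'. v' \<in> C \<Longrightarrow> nsq {..<a} (A v') \<le> nsq {..<a} (A v)"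
    using continuous_attains_sup[OF compact_sphere[of b, folded C_def] _ cont] e by blast
  define s where "s = sqrt (nsq {..<a} (A v))"
  have s2: "s\<^sup>2 = nsq {..<a} (A v)" by (simp add: s_def nsq_nonneg)
  have "0 < (cmod (A e i0))\<^sup>2" using e nz by simp
  also have "\<dots> \<le> nsq {..<a} (A e)" unfolding nsq_def using nz by (intro member_le_sum) auto
  also have "\<dots> \<le> s\<^sup>2" using v(2)[OF e(1)] s2 by simp
  finally have s: "s > 0" using nsq_nonneg[of "{..<a}" "A v"] unfolding s_def by simp
  \<comment> \<open>Maximality on the sphere extends to all vectors by homogeneity.\<close>
  have bound: "nsq {..<a} (A w) \<le> s\<^sup>2 * nsq {..<b} w" if w: "w \<in> vecs b" for w
  proof (cases "nsq {..<b} w = 0")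
    case True
    then have "A w = (\<lambda>_. 0)" by (simp add: A_def nsq_eq_0_iff)
    then show ?thesis using True by (simp add: nsq_def)
  next
    case False
    then have pos: "nsq {..<b} w > 0" using nsq_nonneg[of "{..<b}" w] by simp
    define c where "c = 1 / complex_of_real (sqrt (nsq {..<b} w))"
    have nsq_scale: "nsq J (\<lambda>k. c * x k) = nsq J x / nsq {..<b} w" for J :: "nat set" and x
      using pos by (simp add: nsq_def c_def norm_mult norm_divide power_mult_distrib power_divide sum_divide_distrib)
    have "(\<lambda>k. c * w k) \<in> C" using w pos by (simp add: C_def vecs_def nsq_scale)
    from v(2)[OF this] show ?thesis using pos by (simp add: A_scale nsq_scale s2 field_simps)
  qed
  define u where "u = (\<lambda>i. if i < a then A v i / of_real s else 0)"
  have Av: "A v i = of_real s * u i" if "i < a" for i using that s by (simp add: u_def)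
  have nsq_u: "nsq {..<a} u = 1"
  proof -
    have "nsq {..<a} u = nsq {..<a} (A v) / s\<^sup>2"
      by (simp add: nsq_def u_def norm_divide power_divide sum_divide_distrib)
    moreover have "s\<^sup>2 > 0" using s by simp
    ultimately show ?thesis using s2 by simp
  qed
  \<comment> \<open>The adjoint of \<Phi> applied to u; the goal is \<open>y = s v\<close>.\<close>
  define y where "y = (\<lambda>k. if k < b then \<Sum>i<a. cnj (\<Phi> i k) * u i else 0)"
  have adj: "ip {..<b} w y = ip {..<a} (A w) u" for w
  proof -
    have "ip {..<b} w y = (\<Sum>k<b. \<Sum>i<a. cnj (\<Phi> i k * w k) * u i)"
      by (simp add: ip_def y_def sum_distrib_left mult_ac)
    also have "\<dots> = (\<Sum>i<a. \<Sum>k<b. cnj (\<Phi> i k * w k) * u i)" by (rule sum.swap)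
    also have "\<dots> = ip {..<a} (A w) u"
      by (simp add: ip_def A_def sum_distrib_right)
    finally show ?thesis .
  qed
  have vy: "ip {..<b} v y = of_real s"
  proof -
    have "ip {..<b} v y = ip {..<a} (\<lambda>i. of_real s * u i) u"
      unfolding adj by (rule ip_cong) (simp_all add: Av)
    then show ?thesis by (simp add: ip_scale_left ip_self nsq_u)
  qed
  have yv: "ip {..<b} y v = of_real s" using cnj_ip[of "{..<b}" v y] vy by simp
  \<comment> \<open>Cauchy-Schwarz for \<open><y, y> = <A y, u>\<close> bounds the fourth power of
    the norm of y by s^2 times its square.\<close>
  have "nsq {..<b} y \<le> s\<^sup>2"
  proof (cases "nsq {..<b} y = 0")
    case False
    then have pos: "nsq {..<b} y > 0" using nsq_nonneg[of "{..<b}" y] by simp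
    have "(nsq {..<b} y)\<^sup>2 = (cmod (ip {..<b} y y))\<^sup>2" by (simp add: ip_self)
    also have "\<dots> \<le> nsq {..<a} (A y) * nsq {..<a} u"
      unfolding adj by (rule cauchy_schwarz) simp
    also have "\<dots> \<le> s\<^sup>2 * nsq {..<b} y"
      using bound[of y] by (simp add: nsq_u y_def vecs_def)
    finally show ?thesis using pos by (simp add: power2_eq_square)
  qed simp
  moreover have "complex_of_real (nsq {..<b} (\<lambda>k. y k - of_real s * v k)) = of_real (nsq {..<b} y - s\<^sup>2)"
    using v(1) by (simp add: ip_self[symmetric] ip_diff_left ip_diff_right ip_scale_left ip_scale_right vy yv)
      (simp add: ip_self C_def power2_eq_square)
  then have "nsq {..<b} (\<lambda>k. y k - of_real s * v k) = nsq {..<b} y - s\<^sup>2"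
    by (simp only: of_real_eq_iff)
  ultimately have "nsq {..<b} (\<lambda>k. y k - of_real s * v k) = 0"
    using nsq_nonneg[of "{..<b}" "\<lambda>k. y k - of_real s * v k"] by simp
  then have y: "y k = of_real s * v k" if "k < b" for k
    using that by (simp add: nsq_eq_0_iff)
  have "(\<Sum>i<a. cnj (u i) * \<Phi> i k) = of_real s * cnj (v k)" if "k < b" for k
  proof -
    have "(\<Sum>i<a. cnj (u i) * \<Phi> i k) = cnj (y k)" using that by (simp add: y_def mult.commute)
    then show ?thesis using y[OF that] by simp
  qed
  moreover have "u \<in> vecs a" "v \<in> vecs b" "ip {..<b} v v = 1"
    using v(1) by (simp_all add: u_def vecs_def C_def ip_self)
  moreover have "(\<Sum>k<b. \<Phi> i k * v k) = of_real s * u i" if "i < a" for i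
    using Av[OF that] by (simp add: A_def)
  moreover have "ip {..<a} u u = 1" by (simp add: ip_self nsq_u)
  ultimately show ?thesis
    using s by - (rule exI[of _ s], rule exI[of _ u], rule exI[of _ v], simp)
qed

text \<open>Take as many orthonormal singular pairs as possible; a nonzero remainder would have a singular
  pair of its own, automatically orthogonal to the ones already chosen. Without this existence result
  the \<open>LEAST\<close> in \<open>schmidt_rank\<close> could be a junk value.\<close>

lemma schmidt_decomp_exists: "\<exists>r. schmidt_decomp a b \<Phi> r"
proof -
  define Q where "Q = (\<lambda>r (s :: nat \<Rightarrow> real) u v.
      (\<forall>t<r. 0 < s t \<and> u t \<in> vecs a \<and> v t \<in> vecs b) \<and>
      (\<forall>t<r. \<forall>i<a. (\<Sum>k<b. \<Phi> i k * v t k) = of_real (s t) * u t i) \<and>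
      (\<forall>t<r. \<forall>k<b. (\<Sum>i<a. cnj (u t i) * \<Phi> i k) = of_real (s t) * cnj (v t k)) \<and>
      (\<forall>t<r. \<forall>t'<r. ip {..<a} (u t) (u t') = (if t = t' then 1 else 0)) \<and>
      (\<forall>t<r. \<forall>t'<r. ip {..<b} (v t) (v t') = (if t = t' then 1 else 0)))"
  define P where "P = (\<lambda>r::nat. \<exists>s u v. Q r s u v)"
  have le: "r \<le> a" if Pr: "P r" for r
  proof -
    from Pr obtain s u v where "Q r s u v" unfolding P_def by blast
    then have "\<forall>t<r. \<forall>t'<r. ip {..<a} (u t) (u t') = (if t = t' then 1 else 0)"
      unfolding Q_def by simp
    then show ?thesis using orthonormal_card_le[of "{..<a}" "{..<r}" u] by simp
  qed
  have "P 0" by (simp add: P_def Q_def)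
  define r where "r = Greatest P"
  have r: "P r" "\<And>r'. P r' \<Longrightarrow> r' \<le> r"
    unfolding r_def using GreatestI_nat[of P 0 a] Greatest_le_nat[of P _ a] \<open>P 0\<close> le
    by simp_all
  from r(1) obtain s u v where Q: "Q r s u v" unfolding P_def by blast
  then have pos: "\<And>t. t < r \<Longrightarrow> 0 < s t" "\<And>t. t < r \<Longrightarrow> u t \<in> vecs a" "\<And>t. t < r \<Longrightarrow> v t \<in> vecs b"
    and Av: "\<And>t i. t < r \<Longrightarrow> i < a \<Longrightarrow> (\<Sum>k<b. \<Phi> i k * v t k) = of_real (s t) * u t i"
    and uA: "\<And>t k. t < r \<Longrightarrow> k < b \<Longrightarrow> (\<Sum>i<a. cnj (u t i) * \<Phi> i k) = of_real (s t) * cnj (v t k)"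
    and onu: "\<And>t t'. t < r \<Longrightarrow> t' < r \<Longrightarrow> ip {..<a} (u t) (u t') = (if t = t' then 1 else 0)"
    and onv: "\<And>t t'. t < r \<Longrightarrow> t' < r \<Longrightarrow> ip {..<b} (v t) (v t') = (if t = t' then 1 else 0)"
    unfolding Q_def by simp_all
  \<comment> \<open>The remainder after removing the chosen pairs; it annihilates all of them from
    both sides, which makes any singular pair of R orthogonal to them.\<close>
  define R where "R = (\<lambda>i k. \<Phi> i k - (\<Sum>t<r. of_real (s t) * u t i * cnj (v t k)))"
  have left: "(\<Sum>i<a. cnj (x i) * R i k)
      = (\<Sum>i<a. cnj (x i) * \<Phi> i k) - (\<Sum>t<r. of_real (s t) * cnj (v t k) * ip {..<a} x (u t))" for x k
  proof -
    have "(\<Sum>i<a. cnj (x i) * R i k) = (\<Sum>i<a. cnj (x i) * \<Phi> i k)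
        - (\<Sum>i<a. \<Sum>t<r. cnj (x i) * (of_real (s t) * u t i * cnj (v t k)))"
      by (simp add: R_def algebra_simps sum_subtractf sum_distrib_left)
    also have "(\<Sum>i<a. \<Sum>t<r. cnj (x i) * (of_real (s t) * u t i * cnj (v t k)))
        = (\<Sum>t<r. \<Sum>i<a. cnj (x i) * (of_real (s t) * u t i * cnj (v t k)))" by (rule sum.swap)
    also have "\<dots> = (\<Sum>t<r. of_real (s t) * cnj (v t k) * ip {..<a} x (u t))"
      by (simp add: ip_def sum_distrib_left mult_ac)
    finally show ?thesis .
  qed
  have right: "(\<Sum>k<b. R i k * y k)
      = (\<Sum>k<b. \<Phi> i k * y k) - (\<Sum>t<r. of_real (s t) * u t i * ip {..<b} (v t) y)" for y i
  proof -
    have "(\<Sum>k<b. R i k * y k) = (\<Sum>k<b. \<Phi> i k * y k)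
        - (\<Sum>k<b. \<Sum>t<r. of_real (s t) * u t i * cnj (v t k) * y k)"
      by (simp add: R_def left_diff_distrib sum_subtractf sum_distrib_right)
    also have "(\<Sum>k<b. \<Sum>t<r. of_real (s t) * u t i * cnj (v t k) * y k)
        = (\<Sum>t<r. \<Sum>k<b. of_real (s t) * u t i * cnj (v t k) * y k)" by (rule sum.swap)
    also have "\<dots> = (\<Sum>t<r. of_real (s t) * u t i * ip {..<b} (v t) y)"
      by (simp add: ip_def sum_distrib_left mult_ac)
    finally show ?thesis .
  qed
  have uR: "(\<Sum>i<a. cnj (u t i) * R i k) = 0" if "t < r" "k < b" for t k
  proof -
    have "(\<Sum>t'<r. of_real (s t') * cnj (v t' k) * ip {..<a} (u t) (u t'))
       = (\<Sum>t'<r. if t' = t then of_real (s t) * cnj (v t k) else 0)"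
      by (intro sum.cong) (use onu that in auto)
    then show ?thesis using that by (simp add: left uA)
  qed
  have Rv: "(\<Sum>k<b. R i k * v t k) = 0" if "t < r" "i < a" for t i
  proof -
    have "(\<Sum>t'<r. of_real (s t') * u t' i * ip {..<b} (v t') (v t))
       = (\<Sum>t'<r. if t' = t then of_real (s t) * u t i else 0)"
      by (intro sum.cong) (use onv that in auto)
    then show ?thesis using that by (simp add: right Av)
  qed
  have R0: "R i k = 0" if "i < a" "k < b" for i k
  proof (rule ccontr)
    assume "R i k \<noteq> 0"
    then obtain \<sigma> :: real and x y where xy: "\<sigma> > 0" "x \<in> vecs a" "y \<in> vecs b"
        "ip {..<a} x x = 1" "ip {..<b} y y = 1"
      and Ry: "\<And>i. i < a \<Longrightarrow> (\<Sum>k<b. R i k * y k) = of_real \<sigma> * x i"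
      and xR: "\<And>k. k < b \<Longrightarrow> (\<Sum>i<a. cnj (x i) * R i k) = of_real \<sigma> * cnj (y k)"
      using singular_pair_exists[of i a k b R] \<open>i < a\<close> \<open>k < b\<close> by blast
    have ux: "ip {..<a} (u t) x = 0" if "t < r" for t
    proof -
      have "of_real \<sigma> * ip {..<a} (u t) x = (\<Sum>i<a. cnj (u t i) * (of_real \<sigma> * x i))"
        by (simp add: ip_def sum_distrib_left mult_ac)
      also have "\<dots> = (\<Sum>i<a. \<Sum>k<b. cnj (u t i) * R i k * y k)"
        by (intro sum.cong refl) (simp add: Ry[symmetric] sum_distrib_left mult.assoc)
      also have "\<dots> = (\<Sum>k<b. (\<Sum>i<a. cnj (u t i) * R i k) * y k)"
        unfolding sum_distrib_right by (rule sum.swap)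
      also have "\<dots> = 0" using uR[OF that] by simp
      finally show ?thesis using xy by simp
    qed
    have yv: "ip {..<b} y (v t) = 0" if "t < r" for t
    proof -
      have "of_real \<sigma> * ip {..<b} y (v t) = (\<Sum>k<b. (of_real \<sigma> * cnj (y k)) * v t k)"
        by (simp add: ip_def sum_distrib_left mult_ac)
      also have "\<dots> = (\<Sum>k<b. \<Sum>i<a. cnj (x i) * (R i k * v t k))"
        by (intro sum.cong refl) (simp add: xR[symmetric] sum_distrib_right mult.assoc)
      also have "\<dots> = (\<Sum>i<a. cnj (x i) * (\<Sum>k<b. R i k * v t k))"
        unfolding sum_distrib_left by (rule sum.swap)
      also have "\<dots> = 0" using Rv[OF that] by simp
      finally show ?thesis using xy by simp
    qed
    have xu: "ip {..<a} x (u t) = 0" if "t < r" for t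
      using ux[OF that] by (metis cnj_ip complex_cnj_zero)
    have vy: "ip {..<b} (v t) y = 0" if "t < r" for t
      using yv[OF that] by (metis cnj_ip complex_cnj_zero)
    \<comment> \<open>By orthogonality \<Phi> and R agree on the new pair, so it is a singular pair
      of \<Phi> as well.\<close>
    have "(\<Sum>k<b. \<Phi> i k * y k) = of_real \<sigma> * x i" if "i < a" for i
      using right[of i y] vy Ry[OF that] by simp
    moreover have "(\<Sum>i<a. cnj (x i) * \<Phi> i k) = of_real \<sigma> * cnj (y k)" if "k < b" for k
      using left[of x k] xu xR[OF that] by simp
    ultimately have "Q (Suc r) (s(r := \<sigma>)) (u(r := x)) (v(r := y))"
      unfolding Q_def using pos Av uA onu onv xy ux xu yv vy
      by (simp add: less_Suc_eq all_conj_distrib)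
    then have "P (Suc r)" unfolding P_def by blast
    then show False using r(2)[of "Suc r"] by simp
  qed
  have "schmidt_decomp a b \<Phi> r"
    unfolding schmidt_decomp_def
  \<comment> \<open>Singular vectors on the right enter \<Phi> conjugated, whereas
    \<open>schmidt_decomp\<close> uses its vectors unconjugated.\<close>
  proof (rule exI[of _ s], rule exI[of _ u], rule exI[of _ "\<lambda>t k. cnj (v t k)"], intro conjI)
    have "ip {..<b} (\<lambda>k. cnj (v t k)) (\<lambda>k. cnj (v t' k)) = cnj (ip {..<b} (v t) (v t'))" for t t'
      by (simp add: ip_def)
    then show "\<forall>t<r. \<forall>t'<r. cinner b (\<lambda>k. cnj (v t k)) (\<lambda>k. cnj (v t' k)) = (if t = t' then 1 else 0)"
      using onv by (simp add: cinner_eq_ip)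
    show "\<forall>i<a. \<forall>k<b. \<Phi> i k = (\<Sum>t<r. of_real (s t) * u t i * cnj (v t k))"
      using R0 by (simp add: R_def)
    show "\<forall>t<r. \<forall>t'<r. cinner a (u t) (u t') = (if t = t' then 1 else 0)"
      using onu by (simp add: cinner_eq_ip)
    show "\<forall>t<r. 0 < s t \<and> u t \<in> vecs a \<and> (\<lambda>k. cnj (v t k)) \<in> vecs b"
      using pos by (simp add: vecs_def)
  qed
  then show ?thesis ..
qed

section \<open>From a protocol to a decomposition\<close>

text \<open>The unnormalised state of Bob after Alice's outcome \<open>|e\<rangle>\<langle>e|\<close>.\<close>

definition bob_state :: "(nat \<times> nat) set \<Rightarrow> (nat \<times> nat \<Rightarrow> complex) \<Rightarrow>
    (nat \<Rightarrow> nat \<Rightarrow> nat \<Rightarrow> nat \<Rightarrow> complex) \<Rightarrow> nat \<times> nat \<Rightarrow> complex" where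
  "bob_state P e \<Psi> q = (\<Sum>p\<in>P. cnj (e p) * \<Psi> (fst p) (fst q) (snd p) (snd q))"

text \<open>This reduces a general effect of Alice to rank-one effects: each summand is Bob's effect
  evaluated on the state that one of them leaves him with.\<close>

lemma outcome_prob_rank_one_sum:
  assumes EA: "\<And>p p'. p \<in> {..<dA} \<times> {..<a} \<Longrightarrow> p' \<in> {..<dA} \<times> {..<a} \<Longrightarrow>
      EA p p' = (\<Sum>s<n. e s p * cnj (e s p'))"
  shows "outcome_prob dA dB a b \<Psi> EA FB = (\<Sum>s<(n::nat). sesq ({..<dB} \<times> {..<b}) FB
      (bob_state ({..<dA} \<times> {..<a}) (e s) \<Psi>) (bob_state ({..<dA} \<times> {..<a}) (e s) \<Psi>))"
proof -
  define P where "P = {..<dA} \<times> {..<a}"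
  define R where "R = {..<dB} \<times> {..<b}"
  define \<psi> where "\<psi> = (\<lambda>p q. \<Psi> (fst p) (fst q) (snd p) (snd q))"
  define B where "B = (\<lambda>s. bob_state P (e s) \<Psi>)"
  have "outcome_prob dA dB a b \<Psi> EA FB
      = (\<Sum>p\<in>P. \<Sum>q\<in>R. \<Sum>p'\<in>P. \<Sum>q'\<in>R. cnj (\<psi> p q) * EA p p' * FB q q' * \<psi> p' q')"
    unfolding outcome_prob_def P_def R_def \<psi>_def ..
  also have "\<dots> = (\<Sum>q\<in>R. \<Sum>p\<in>P. \<Sum>p'\<in>P. \<Sum>q'\<in>R. cnj (\<psi> p q) * EA p p' * FB q q' * \<psi> p' q')"
    by (rule sum.swap)
  also have "\<dots> = (\<Sum>q\<in>R. \<Sum>p\<in>P. \<Sum>q'\<in>R. \<Sum>p'\<in>P. cnj (\<psi> p q) * EA p p' * FB q q' * \<psi> p' q')"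
    by (intro sum.cong refl sum.swap)
  also have "\<dots> = (\<Sum>q\<in>R. \<Sum>q'\<in>R. \<Sum>p\<in>P. \<Sum>p'\<in>P. cnj (\<psi> p q) * EA p p' * FB q q' * \<psi> p' q')"
    by (intro sum.cong refl sum.swap)
  also have "\<dots> = (\<Sum>q\<in>R. \<Sum>q'\<in>R. \<Sum>s<n. cnj (B s q) * FB q q' * B s q')"
  proof (intro sum.cong refl)
    fix q q'
    have "(\<Sum>p\<in>P. \<Sum>p'\<in>P. cnj (\<psi> p q) * EA p p' * FB q q' * \<psi> p' q')
      = (\<Sum>p\<in>P. \<Sum>p'\<in>P. \<Sum>s<n. (e s p * cnj (\<psi> p q)) * (FB q q' * (cnj (e s p') * \<psi> p' q')))"
      by (intro sum.cong refl) (simp add: EA P_def sum_distrib_left sum_distrib_right mult_ac)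
    also have "\<dots> = (\<Sum>p\<in>P. \<Sum>s<n. \<Sum>p'\<in>P. (e s p * cnj (\<psi> p q)) * (FB q q' * (cnj (e s p') * \<psi> p' q')))"
      by (intro sum.cong refl sum.swap)
    also have "\<dots> = (\<Sum>s<n. \<Sum>p\<in>P. \<Sum>p'\<in>P. (e s p * cnj (\<psi> p q)) * (FB q q' * (cnj (e s p') * \<psi> p' q')))"
      by (rule sum.swap)
    also have "\<dots> = (\<Sum>s<n. cnj (B s q) * (FB q q' * B s q'))"
    proof (intro sum.cong refl)
      fix s
      have "cnj (B s q) = (\<Sum>p\<in>P. e s p * cnj (\<psi> p q))"
        by (simp add: B_def bob_state_def \<psi>_def)
      moreover have "FB q q' * B s q' = (\<Sum>p'\<in>P. FB q q' * (cnj (e s p') * \<psi> p' q'))"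
        by (simp add: B_def bob_state_def \<psi>_def sum_distrib_left)
      ultimately show "(\<Sum>p\<in>P. \<Sum>p'\<in>P. e s p * cnj (\<psi> p q) * (FB q q' * (cnj (e s p') * \<psi> p' q')))
        = cnj (B s q) * (FB q q' * B s q')" by (simp only: sum_product)
    qed
    finally show "(\<Sum>p\<in>P. \<Sum>p'\<in>P. cnj (\<psi> p q) * EA p p' * FB q q' * \<psi> p' q')
      = (\<Sum>s<n. cnj (B s q) * FB q q' * B s q')" by (simp add: mult.assoc)
  qed
  also have "\<dots> = (\<Sum>q\<in>R. \<Sum>s<n. \<Sum>q'\<in>R. cnj (B s q) * FB q q' * B s q')"
    by (intro sum.cong refl sum.swap)
  also have "\<dots> = (\<Sum>s<n. \<Sum>q\<in>R. \<Sum>q'\<in>R. cnj (B s q) * FB q q' * B s q')"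
    by (rule sum.swap)
  finally show ?thesis unfolding sesq_def B_def P_def R_def .
qed

text \<open>The matrix T of the overview: \<Phi> occupies only A' and B', so contracting it with e
  over A' leaves the index of A open.\<close>

definition steer :: "nat \<Rightarrow> (nat \<times> nat \<Rightarrow> complex) \<Rightarrow> (nat \<Rightarrow> nat \<Rightarrow> complex) \<Rightarrow> nat \<Rightarrow> nat \<Rightarrow> complex" where
  "steer a e \<Phi> i k = (\<Sum>i'<a. cnj (e (i, i')) * \<Phi> i' k)"

definition steer_gram :: "nat \<Rightarrow> nat \<Rightarrow> (nat \<times> nat \<Rightarrow> complex) \<Rightarrow> (nat \<Rightarrow> nat \<Rightarrow> complex) \<Rightarrow> nat \<Rightarrow> nat \<Rightarrow> complex" where
  "steer_gram a b e \<Phi> i j = (\<Sum>k<b. cnj (steer a e \<Phi> i k) * steer a e \<Phi> j k)"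

lemma bob_state_product:
  "bob_state ({..<dA} \<times> {..<a}) e (\<lambda>i k i' k'. \<psi> i k * \<Phi> i' k') q
    = (\<Sum>i<dA. \<psi> i (fst q) * steer a e \<Phi> i (snd q))"
  unfolding bob_state_def steer_def sum_distrib_left sum.cartesian_product
  by (simp add: case_prod_beta mult_ac)

text \<open>The right-hand side is the matrix element of \<open>Q \<otimes> I\<close> between the
  two states, with Q the Gram matrix: the spaces A' and B' have disappeared from the
  condition.\<close>

lemma ip_bob_state:
  "ip ({..<dB} \<times> {..<b}) (bob_state ({..<dA} \<times> {..<a}) e (\<lambda>i k i' k'. \<psi> i k * \<Phi> i' k'))
      (bob_state ({..<dA} \<times> {..<a}) e (\<lambda>i k i' k'. \<phi> i k * \<Phi> i' k'))
    = (\<Sum>k<dB. sesq {..<dA} (steer_gram a b e \<Phi>) (\<lambda>i. \<psi> i k) (\<lambda>i. \<phi> i k))"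
proof -
  let ?T = "steer a e \<Phi>"
  have "ip ({..<dB} \<times> {..<b}) (bob_state ({..<dA} \<times> {..<a}) e (\<lambda>i k i' k'. \<psi> i k * \<Phi> i' k'))
      (bob_state ({..<dA} \<times> {..<a}) e (\<lambda>i k i' k'. \<phi> i k * \<Phi> i' k'))
    = (\<Sum>k<dB. \<Sum>k'<b. (\<Sum>i<dA. cnj (\<psi> i k * ?T i k')) * (\<Sum>j<dA. \<phi> j k * ?T j k'))"
    unfolding ip_def bob_state_product sum.cartesian_product by (simp add: case_prod_beta)
  also have "\<dots> = (\<Sum>k<dB. \<Sum>k'<b. \<Sum>i<dA. \<Sum>j<dA. cnj (\<psi> i k) * (cnj (?T i k') * ?T j k') * \<phi> j k)"
    unfolding sum_product by (intro sum.cong refl) (simp add: mult_ac)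
  also have "\<dots> = (\<Sum>k<dB. \<Sum>i<dA. \<Sum>k'<b. \<Sum>j<dA. cnj (\<psi> i k) * (cnj (?T i k') * ?T j k') * \<phi> j k)"
    by (intro sum.cong refl sum.swap)
  also have "\<dots> = (\<Sum>k<dB. \<Sum>i<dA. \<Sum>j<dA. \<Sum>k'<b. cnj (\<psi> i k) * (cnj (?T i k') * ?T j k') * \<phi> j k)"
    by (intro sum.cong refl sum.swap)
  also have "\<dots> = (\<Sum>k<dB. sesq {..<dA} (steer_gram a b e \<Phi>) (\<lambda>i. \<psi> i k) (\<lambda>i. \<phi> i k))"
    by (simp add: sesq_def steer_gram_def sum_distrib_left sum_distrib_right)
  finally show ?thesis .
qed

section \<open>Joint eigenspaces of the Gram matrices\<close>

lemma sesq_right_eigen: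
  assumes "\<And>i. i \<in> I \<Longrightarrow> (\<Sum>j\<in>I. Q i j * v j) = \<mu> * v i"
  shows "sesq I Q u v = \<mu> * ip I u v"
proof -
  have "sesq I Q u v = (\<Sum>i\<in>I. cnj (u i) * (\<Sum>j\<in>I. Q i j * v j))"
    by (simp add: sesq_def sum_distrib_left mult.assoc)
  also have "\<dots> = (\<Sum>i\<in>I. cnj (u i) * (\<mu> * v i))" using assms by simp
  finally show ?thesis by (simp add: ip_def sum_distrib_left mult_ac)
qed

lemma sesq_hermitian:
  assumes "\<And>i j. i \<in> I \<Longrightarrow> j \<in> I \<Longrightarrow> Q j i = cnj (Q i j)"
  shows "cnj (sesq I Q u v) = sesq I Q v u"
proof -
  have "cnj (sesq I Q u v) = (\<Sum>i\<in>I. \<Sum>j\<in>I. cnj (v j) * Q j i * u i)"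
    unfolding sesq_def cnj_sum
    by (intro sum.cong refl) (simp add: assms[symmetric] mult_ac)
  also have "\<dots> = sesq I Q v u" unfolding sesq_def by (rule sum.swap)
  finally show ?thesis .
qed

text \<open>Since \<open>\<psi>\<close> is a complete basis, the off-diagonal condition makes every \<open>\<psi> j\<close> an eigenvector of
  every \<open>Q \<xi> \<otimes> I\<close>, that is, its columns lie in a joint eigenspace of the \<open>Q \<xi>\<close>; as the columns span,
  the joint eigenspaces decompose the space. On each of them some \<open>Q \<xi>\<close> is a nonzero multiple of the
  identity, because the \<open>Q \<xi>\<close> add up to \<open>I\<close>, so its dimension is at most the rank of that \<open>Q \<xi>\<close>.\<close>

lemma joint_eigenspace_decomposition:
  fixes Q :: "'x \<Rightarrow> nat \<Rightarrow> nat \<Rightarrow> complex"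
  assumes d: "0 < dA" "0 < dB" and on: "orthonormal_family dA dB (dA * dB) \<psi>"
    and fin: "finite X"
    and herm: "\<And>\<xi> i j. \<xi> \<in> X \<Longrightarrow> i < dA \<Longrightarrow> j < dA \<Longrightarrow> Q \<xi> j i = cnj (Q \<xi> i j)"
    and off: "\<And>\<xi> j l. \<xi> \<in> X \<Longrightarrow> j < dA * dB \<Longrightarrow> l < dA * dB \<Longrightarrow> j \<noteq> l \<Longrightarrow>
       (\<Sum>k<dB. sesq {..<dA} (Q \<xi>) (\<lambda>i. \<psi> j i k) (\<lambda>i. \<psi> l i k)) = 0"
    and one: "\<And>i j. i < dA \<Longrightarrow> j < dA \<Longrightarrow> (\<Sum>\<xi>\<in>X. Q \<xi> i j) = (if i = j then 1 else 0)"
    and rank: "\<And>\<xi> i j. \<xi> \<in> X \<Longrightarrow> i < dA \<Longrightarrow> j < dA \<Longrightarrow> Q \<xi> i j = (\<Sum>t<r. w \<xi> t i * z \<xi> t j)"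
  shows "\<exists>K M. 0 < K \<and> orth_decomp dA K M \<and> (\<forall>j<dA * dB. \<exists>k<K. in_tensor_sub dA dB (M k) (\<psi> j))
    \<and> (\<forall>k<K. cdim (M k) \<le> r)"
proof -
  define N where "N = dA * dB"
  define I where "I = {..<dA} \<times> {..<dB}"
  define \<psi>' where "\<psi>' = (\<lambda>j p. \<psi> j (fst p) (snd p))"
  have ip_I: "ip I (\<psi>' j) f = (\<Sum>i<dA. \<Sum>k<dB. cnj (\<psi> j i k) * f (i, k))" for j f
    unfolding ip_def I_def \<psi>'_def sum.cartesian_product by (simp add: case_prod_beta)
  have on': "ip I (\<psi>' j) (\<psi>' l) = (if j = l then 1 else 0)" if "j < N" "l < N" for j l
    using on that unfolding ip_I orthonormal_family_def N_def by (simp add: \<psi>'_def)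
  have complete: "f (i, k) = (\<Sum>j<N. ip I (\<psi>' j) f * \<psi> j i k)" if "i < dA" "k < dB" for f i k
    using orthonormal_complete[of I "{..<N}" \<psi>' "(i, k)" f] on' that
    by (simp add: I_def N_def \<psi>'_def card_cartesian_product)

  \<comment> \<open>The value 0 outside X ensures that two different eigenvalue functions differ at
    some element of X.\<close>
  define lam where "lam = (\<lambda>l \<xi>. if \<xi> \<in> X
      then \<Sum>k<dB. sesq {..<dA} (Q \<xi>) (\<lambda>i. \<psi> l i k) (\<lambda>i. \<psi> l i k) else 0)"
  have lam_real: "cnj (lam l \<xi>) = lam l \<xi>" for l \<xi>
  proof (cases "\<xi> \<in> X")
    case True
    have "cnj (sesq {..<dA} (Q \<xi>) u u) = sesq {..<dA} (Q \<xi>) u u" for u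
      by (rule sesq_hermitian, rule herm[OF True]) simp_all
    then show ?thesis by (simp add: lam_def)
  qed (simp add: lam_def)
  have eig: "(\<Sum>j<dA. Q \<xi> i j * \<psi> l j k) = lam l \<xi> * \<psi> l i k"
    if "\<xi> \<in> X" "l < N" "i < dA" "k < dB" for \<xi> l i k
  proof -
    \<comment> \<open>This is \<open>Q \<xi> \<otimes> I\<close> applied to \<open>\<psi> l\<close>;
      its coefficients in the basis are the matrix elements, of which only the diagonal one
      survives.\<close>
    define f where "f = (\<lambda>(i, k). \<Sum>j<dA. Q \<xi> i j * \<psi> l j k)"
    have "ip I (\<psi>' j) f = (\<Sum>k<dB. sesq {..<dA} (Q \<xi>) (\<lambda>i. \<psi> j i k) (\<lambda>i. \<psi> l i k))" for j
    proof -
      have "ip I (\<psi>' j) f = (\<Sum>i<dA. \<Sum>k<dB. \<Sum>i'<dA. cnj (\<psi> j i k) * Q \<xi> i i' * \<psi> l i' k)"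
        by (simp add: ip_I f_def sum_distrib_left mult.assoc)
      also have "\<dots> = (\<Sum>k<dB. \<Sum>i<dA. \<Sum>i'<dA. cnj (\<psi> j i k) * Q \<xi> i i' * \<psi> l i' k)"
        by (rule sum.swap)
      finally show ?thesis by (simp add: sesq_def)
    qed
    then have "ip I (\<psi>' j) f = (if j = l then lam l \<xi> else 0)" if "j < N" for j
      using off[OF \<open>\<xi> \<in> X\<close>, of j l] that \<open>l < N\<close> \<open>\<xi> \<in> X\<close> by (simp add: lam_def N_def)
    then have "f (i, k) = (\<Sum>j<N. (if j = l then lam l \<xi> else 0) * \<psi> j i k)"
      using complete[of i k f] that by simp
    also have "\<dots> = (\<Sum>j<N. if j = l then lam l \<xi> * \<psi> l i k else 0)"
      by (intro sum.cong) auto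
    finally show ?thesis using that by (simp add: f_def)
  qed

  define Eig where "Eig = (\<lambda>\<mu>. {v \<in> vecs dA. \<forall>\<xi>\<in>X. \<forall>i<dA. (\<Sum>j<dA. Q \<xi> i j * v j) = \<mu> \<xi> * v i})"
  define col where "col = (\<lambda>j k i. if i < dA then \<psi> j i k else 0)"
  have col: "col l k \<in> Eig (lam l)" if "l < N" "k < dB" for l k
    using eig that by (simp add: Eig_def col_def vecs_def)
  have sub: "csubspace dA (Eig \<mu>)" for \<mu>
    by (auto simp: csubspace_def Eig_def vecs_def algebra_simps sum.distrib simp flip: sum_distrib_left)
  \<comment> \<open>Eigenvectors of a hermitian matrix for distinct real eigenvalues are
    orthogonal.\<close>
  have orth: "ip {..<dA} u v = 0"
    if uv: "u \<in> Eig (lam l)" "v \<in> Eig (lam l')" "lam l \<noteq> lam l'" for u v l l'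
  proof -
    obtain \<xi> where \<xi>: "lam l \<xi> \<noteq> lam l' \<xi>" using uv(3) by blast
    then have "\<xi> \<in> X" by (auto simp: lam_def split: if_splits)
    have 1: "sesq {..<dA} (Q \<xi>) u v = lam l' \<xi> * ip {..<dA} u v"
      using that(2) \<open>\<xi> \<in> X\<close> by (intro sesq_right_eigen) (simp add: Eig_def)
    have "sesq {..<dA} (Q \<xi>) v u = lam l \<xi> * ip {..<dA} v u"
      using that(1) \<open>\<xi> \<in> X\<close> by (intro sesq_right_eigen) (simp add: Eig_def)
    then have "cnj (sesq {..<dA} (Q \<xi>) v u) = lam l \<xi> * ip {..<dA} u v"
      by (simp add: lam_real cnj_ip)
    moreover have "cnj (sesq {..<dA} (Q \<xi>) v u) = sesq {..<dA} (Q \<xi>) u v"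
      by (rule sesq_hermitian, rule herm[OF \<open>\<xi> \<in> X\<close>]) simp_all
    ultimately show ?thesis using 1 \<xi> by simp
  qed

  have dim: "cdim (Eig \<mu>) \<le> r" for \<mu>
  proof (rule cdim_le)
    fix S assume S: "S \<subseteq> Eig \<mu>" "cindep S"
    show "card S \<le> r"
    proof (cases "\<exists>\<xi>\<in>X. \<mu> \<xi> \<noteq> 0")
      case True
      then obtain \<xi> where \<xi>: "\<xi> \<in> X" "\<mu> \<xi> \<noteq> 0" by blast
      show ?thesis
      proof (rule cindep_card_le[OF S(2)])
        fix v i assume "v \<in> S"
        then have v: "v \<in> Eig \<mu>" using S by blast
        \<comment> \<open>Dividing the eigenvalue equation by \<open>\<mu> \<xi>\<close> places v in
          the range of \<open>Q \<xi>\<close>, spanned by the r vectors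
          \<open>w \<xi> t\<close>.\<close>
        show "v i = (\<Sum>t<r. ((\<Sum>j<dA. z \<xi> t j * v j) / \<mu> \<xi>) * (if i < dA then w \<xi> t i else 0))"
        proof (cases "i < dA")
          case True
          have "\<mu> \<xi> * v i = (\<Sum>j<dA. Q \<xi> i j * v j)" using v \<xi> True by (simp add: Eig_def)
          also have "\<dots> = (\<Sum>j<dA. \<Sum>t<r. w \<xi> t i * (z \<xi> t j * v j))"
            using rank[OF \<xi>(1) True] by (simp add: sum_distrib_right mult.assoc)
          also have "\<dots> = (\<Sum>t<r. \<Sum>j<dA. w \<xi> t i * (z \<xi> t j * v j))" by (rule sum.swap)
          finally have "v i = (\<Sum>t<r. w \<xi> t i * (\<Sum>j<dA. z \<xi> t j * v j)) / \<mu> \<xi>"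
            using \<xi>(2) by (simp add: sum_distrib_left field_simps)
          also have "\<dots> = (\<Sum>t<r. w \<xi> t i * (\<Sum>j<dA. z \<xi> t j * v j) / \<mu> \<xi>)"
            by (rule sum_divide_distrib)
          finally show ?thesis using True by (simp add: mult.commute)
        qed (use v in \<open>simp add: Eig_def vecs_def\<close>)
      qed
    next
      case False
      \<comment> \<open>If all eigenvalues vanish, so does v, being the sum of all
        \<open>Q \<xi> v\<close>.\<close>
      have "v i = 0" if "v \<in> S" for v i
      proof (cases "i < dA")
        case True
        have "v i = (\<Sum>j<dA. if i = j then v j else 0)" using True by simp
        also have "\<dots> = (\<Sum>j<dA. (\<Sum>\<xi>\<in>X. Q \<xi> i j) * v j)"
          using True one by (intro sum.cong) auto
        also have "\<dots> = (\<Sum>\<xi>\<in>X. \<Sum>j<dA. Q \<xi> i j * v j)"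
          unfolding sum_distrib_right by (rule sum.swap)
        also have "\<dots> = 0" using that S True False by (intro sum.neutral) (auto simp: Eig_def)
        finally show ?thesis .
      qed (use that S in \<open>auto simp: Eig_def vecs_def\<close>)
      then have "card S \<le> 0" by (intro cindep_card_le[OF S(2)]) simp
      then show ?thesis by simp
    qed
  qed

  define K where "K = card (lam ` {..<N})"
  obtain h where h: "bij_betw h {..<K} (lam ` {..<N})"
    unfolding K_def using ex_bij_betw_nat_finite[of "lam ` {..<N}"] by (auto simp: atLeast0LessThan)
  have "0 < K" using d by (simp add: K_def N_def card_gt_0_iff lessThan_empty_iff)
  have h_mem: "\<exists>l<N. h k = lam l" if "k < K" for k
    using bij_betwE[OF h] that by auto
  have h_surj: "\<exists>k<K. h k = lam l" if "l < N" for l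
    using bij_betw_imp_surj_on[OF h] that by (metis image_iff lessThan_iff)
  have "orth_decomp dA K (\<lambda>k. Eig (h k))"
    unfolding orth_decomp_def
  proof (intro conjI allI impI ballI)
    fix k l u v assume kl: "k < K" "l < K" "k \<noteq> l" "u \<in> Eig (h k)" "v \<in> Eig (h l)"
    have "h k \<noteq> h l" using bij_betw_imp_inj_on[OF h] kl by (auto dest: inj_onD)
    then show "cinner dA u v = 0"
      using kl h_mem orth unfolding cinner_eq_ip by metis
  next
    fix v assume v: "v \<in> vecs dA"
    \<comment> \<open>The tensor of v with the basis vector 0 of Bob's space, which exists since
      \<open>0 < dB\<close>. Expanding it in \<psi> and reading off column 0 writes v as a
      combination of columns, then grouped by eigenvalue function.\<close>
    define f where "f = (\<lambda>(i, k). if k = (0::nat) then v i else 0)"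
    define c where "c = (\<lambda>j. ip I (\<psi>' j) f)"
    define u where "u = (\<lambda>\<mu> i. \<Sum>j\<in>{j \<in> {..<N}. lam j = \<mu>}. c j * col j 0 i)"
    have "u \<mu> \<in> Eig \<mu>" for \<mu>
      unfolding u_def using d col
      by (intro csubspace_sum[OF sub] csubspace_scale[OF sub]) auto
    moreover have "v i = (\<Sum>k<K. u (h k) i)" for i
    proof -
      have "(\<Sum>k<K. u (h k) i) = (\<Sum>\<mu>\<in>lam ` {..<N}. u \<mu> i)"
        by (rule sum.reindex_bij_betw[OF h])
      also have "\<dots> = (\<Sum>j<N. c j * col j 0 i)"
        unfolding u_def by (rule sum.group) auto
      also have "\<dots> = v i"
        using v complete[of i 0 f] d by (cases "i < dA") (simp_all add: col_def f_def c_def vecs_def)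
      finally show ?thesis by simp
    qed
    ultimately show "\<exists>u. (\<forall>k<K. u k \<in> Eig (h k)) \<and> (\<forall>i. v i = (\<Sum>k<K. u k i))"
      by (intro exI[of _ "\<lambda>k. u (h k)"]) simp
  qed (rule sub)
  moreover have "\<exists>k<K. in_tensor_sub dA dB (Eig (h k)) (\<psi> j)" if j: "j < dA * dB" for j
  proof -
    obtain k where k: "k < K" "h k = lam j" using h_surj j unfolding N_def by blast
    have "\<psi> j i l = (\<Sum>t<dB. col j t i * (if l = t then 1 else 0))" if "i < dA" "l < dB" for i l
      using that by (simp add: col_def if_distrib[of "\<lambda>c. _ * c"] cong: if_cong)
    moreover have "(\<lambda>l. if l = t then 1 else 0) \<in> vecs dB" if "t < dB" for t
      using that by (simp add: vecs_def)
    ultimately have "in_tensor_sub dA dB (Eig (h k)) (\<psi> j)"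
      unfolding in_tensor_sub_def k(2) using col j unfolding N_def
      by - (rule exI[of _ dB], rule exI[of _ "col j"],
          rule exI[of _ "\<lambda>t l. if l = t then 1 else 0"], simp)
    with k show ?thesis by blast
  qed
  ultimately show ?thesis 
    using \<open>0 < K\<close> dim by - (rule exI[of _ K], rule exI[of _ "\<lambda>k. Eig (h k)"], simp)
qed

lemma decomposition_from_protocol:
  assumes d: "0 < dA" "0 < dB" and on: "orthonormal_family dA dB (dA * dB) \<psi>"
    and st: "is_state a b \<Phi>" and dist: "one_way_locc_dist dA dB (dA * dB) \<psi> a b \<Phi>"
    and sd: "schmidt_decomp a b \<Phi> r"
  shows "\<exists>K M. 0 < K \<and> orth_decomp dA K M \<and> (\<forall>j<dA * dB. \<exists>k<K. in_tensor_sub dA dB (M k) (\<psi> j))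
    \<and> (\<forall>k<K. cdim (M k) \<le> r)"
proof -
  define P where "P = {..<dA} \<times> {..<a}"
  define R where "R = {..<dB} \<times> {..<b}"
  have finR: "finite R" by (simp add: R_def)
  define prod where "prod = (\<lambda>j i k i' k'. \<psi> j i k * \<Phi> i' k')"
  obtain nA :: nat and EA nB F g where EA: "povm P nA EA" and F: "\<And>x. x < nA \<Longrightarrow> povm R (nB x) (F x)"
    and g: "\<And>j x y. j < dA * dB \<Longrightarrow> x < nA \<Longrightarrow> y < nB x \<Longrightarrow> g x y \<noteq> j \<Longrightarrow>
        outcome_prob dA dB a b (prod j) (EA x) (F x y) = 0"
    using dist unfolding one_way_locc_dist_def P_def R_def prod_def by blast
  define G where "G = (\<lambda>x ne. \<forall>p\<in>P. \<forall>q\<in>P.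
      EA x p q = (\<Sum>s<(fst ne :: nat). snd ne s p * cnj (snd ne s q)))"
  have "\<exists>ne. G x ne" if "x < nA" for x
  proof -
    have "psd_on P (EA x)" using EA that by (simp add: povm_def)
    then obtain n :: nat and e where "\<forall>p\<in>P. \<forall>q\<in>P. EA x p q = (\<Sum>s<n. e s p * cnj (e s q))"
      using psd_rank_one_sum[of P "EA x"] by (auto simp: P_def)
    then show ?thesis by (intro exI[of _ "(n, e)"]) (simp add: G_def)
  qed
  then have "\<forall>x\<in>{..<nA}. \<exists>ne. G x ne" by simp
  from bchoice[OF this] obtain ne where ne: "\<forall>x\<in>{..<nA}. G x (ne x)" ..
  define n where "n = (\<lambda>x. fst (ne x))"
  define e where "e = (\<lambda>x. snd (ne x))"
  have e: "EA x p q = (\<Sum>s<n x. e x s p * cnj (e x s q))" if "x < nA" "p \<in> P" "q \<in> P" for x p q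
    using ne that by (simp add: G_def n_def e_def)
  \<comment> \<open>Alice's measurement refined into rank-one effects: outcome x together with a
    summand s.\<close>
  define X where "X = Sigma {..<nA} (\<lambda>x. {..<n x})"
  define \<epsilon> where "\<epsilon> = (\<lambda>(x, s). e x s)"
  define B where "B = (\<lambda>\<xi> j. bob_state P (\<epsilon> \<xi>) (prod j))"
  define Q where "Q = (\<lambda>\<xi>. steer_gram a b (\<epsilon> \<xi>) \<Phi>)"
  have resolution: "(\<Sum>\<xi>\<in>X. \<epsilon> \<xi> p * cnj (\<epsilon> \<xi> q)) = (if p = q then 1 else 0)" if "p \<in> P" "q \<in> P" for p q
  proof -
    have "(\<Sum>\<xi>\<in>X. \<epsilon> \<xi> p * cnj (\<epsilon> \<xi> q)) = (\<Sum>x<nA. \<Sum>s<n x. e x s p * cnj (e x s q))"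
      unfolding X_def \<epsilon>_def by (subst sum.Sigma) (auto simp: case_prod_beta)
    also have "\<dots> = (\<Sum>x<nA. EA x p q)" using e that by simp
    finally show ?thesis using EA that by (simp add: povm_def)
  qed
  \<comment> \<open>The probability is a sum of nonnegative terms over s, so if it vanishes, each
    refined term does.\<close>
  have null: "sesq R (F x y) (B (x, s) j) (B (x, s) j) = 0"
    if "j < dA * dB" "x < nA" "s < n x" "y < nB x" "g x y \<noteq> j" for x s y j
  proof -
    have psd: "psd_on R (F x y)" using F that by (simp add: povm_def)
    have "(\<Sum>s<n x. sesq R (F x y) (B (x, s) j) (B (x, s) j)) = outcome_prob dA dB a b (prod j) (EA x) (F x y)"
      unfolding B_def R_def P_def \<epsilon>_def prod.case
      by (rule outcome_prob_rank_one_sum[symmetric]) (use e that in \<open>simp add: P_def\<close>)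
    also have "\<dots> = 0" using g that by simp
    finally have "(\<Sum>s<n x. Re (sesq R (F x y) (B (x, s) j) (B (x, s) j))) = 0"
      by (simp flip: Re_sum)
    moreover have "\<forall>s. 0 \<le> Re (sesq R (F x y) (B (x, s) j) (B (x, s) j))"
      using psd by (simp add: psd_on_iff)
    ultimately have "Re (sesq R (F x y) (B (x, s) j) (B (x, s) j)) = 0"
      using that by (simp add: sum_nonneg_eq_0_iff)
    then show ?thesis using psd by (simp add: psd_on_iff complex_eq_iff complex_is_Real_iff)
  qed
  have orth: "ip R (B \<xi> j) (B \<xi> l) = 0" if \<xi>: "\<xi> \<in> X" and jl: "j < dA * dB" "l < dA * dB" "j \<noteq> l" for \<xi> j l
  proof -
    obtain x s where xs: "\<xi> = (x, s)" "x < nA" "s < n x" using \<xi> by (auto simp: X_def)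
    have "sesq R (F x y) (B \<xi> j) (B \<xi> l) = 0" if y: "y < nB x" for y
    proof -
      have psd: "psd_on R (F x y)" using F xs y by (simp add: povm_def)
      show ?thesis
      \<comment> \<open>The guess cannot be both j and l, so for every y one of the two states is a
        null vector of Bob's effect.\<close>
      proof (cases "g x y = l")
        case True
        then show ?thesis
          using psd_null(2)[OF finR psd null] xs jl y by simp
      next
        case False
        then show ?thesis
          using psd_null(1)[OF finR psd null] xs jl y by simp
      qed
    qed
    then have "0 = sesq R (\<lambda>p q. \<Sum>y<nB x. F x y p q) (B \<xi> j) (B \<xi> l)"
      by (simp add: sesq_sum)
    also have "\<dots> = sesq R (\<lambda>p q. if p = q then 1 else 0) (B \<xi> j) (B \<xi> l)"
      using F[OF xs(2)] by (intro sesq_cong) (simp add: povm_def)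
    finally show ?thesis by (simp add: sesq_id finR)
  qed
  from sd obtain sv :: "nat \<Rightarrow> real" and u v where
    \<Phi>: "\<And>i k. i < a \<Longrightarrow> k < b \<Longrightarrow> \<Phi> i k = (\<Sum>t<r. of_real (sv t) * u t i * v t k)"
    unfolding schmidt_decomp_def by blast
  \<comment> \<open>The Schmidt decomposition factors T through r dimensions, which yields the rank
    bound for \<open>Q \<xi>\<close>.\<close>
  define W where "W = (\<lambda>\<xi> t i. of_real (sv t) * (\<Sum>i'<a. cnj (\<epsilon> \<xi> (i, i')) * u t i'))"
  have steer: "steer a (\<epsilon> \<xi>) \<Phi> i k = (\<Sum>t<r. W \<xi> t i * v t k)" if "k < b" for \<xi> i k
  proof -
    have "steer a (\<epsilon> \<xi>) \<Phi> i k = (\<Sum>i'<a. \<Sum>t<r. cnj (\<epsilon> \<xi> (i, i')) * (of_real (sv t) * u t i' * v t k))"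
      using \<Phi> that by (simp add: steer_def sum_distrib_left)
    also have "\<dots> = (\<Sum>t<r. \<Sum>i'<a. cnj (\<epsilon> \<xi> (i, i')) * (of_real (sv t) * u t i' * v t k))"
      by (rule sum.swap)
    also have "\<dots> = (\<Sum>t<r. W \<xi> t i * v t k)"
      by (simp add: W_def sum_distrib_left sum_distrib_right mult_ac)
    finally show ?thesis .
  qed
  show ?thesis
  proof (rule joint_eigenspace_decomposition[OF d on, where X = X and Q = Q
      and w = "\<lambda>\<xi> t i. cnj (W \<xi> t i)" and z = "\<lambda>\<xi> t j. \<Sum>k<b. cnj (v t k) * steer a (\<epsilon> \<xi>) \<Phi> j k"])
    show "finite X" by (simp add: X_def)
    show "Q \<xi> j i = cnj (Q \<xi> i j)" for \<xi> i j
      by (simp add: Q_def steer_gram_def mult.commute)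
    show "(\<Sum>k<dB. sesq {..<dA} (Q \<xi>) (\<lambda>i. \<psi> j i k) (\<lambda>i. \<psi> l i k)) = 0"
      if "\<xi> \<in> X" "j < dA * dB" "l < dA * dB" "j \<noteq> l" for \<xi> j l
      using orth[OF that] unfolding Q_def B_def R_def P_def prod_def ip_bob_state .
    show "Q \<xi> i j = (\<Sum>t<r. cnj (W \<xi> t i) * (\<Sum>k<b. cnj (v t k) * steer a (\<epsilon> \<xi>) \<Phi> j k))" for \<xi> i j
    proof -
      have "Q \<xi> i j = (\<Sum>k<b. \<Sum>t<r. cnj (W \<xi> t i) * (cnj (v t k) * steer a (\<epsilon> \<xi>) \<Phi> j k))"
        unfolding Q_def steer_gram_def
        by (intro sum.cong refl) (simp add: steer[of _ _ i] sum_distrib_right mult.assoc)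
      also have "\<dots> = (\<Sum>t<r. \<Sum>k<b. cnj (W \<xi> t i) * (cnj (v t k) * steer a (\<epsilon> \<xi>) \<Phi> j k))"
        by (rule sum.swap)
      finally show ?thesis by (simp add: sum_distrib_left)
    qed
    show "(\<Sum>\<xi>\<in>X. Q \<xi> i j) = (if i = j then 1 else 0)" if ij: "i < dA" "j < dA" for i j
    proof -
      \<comment> \<open>The resolution of the identity on A A' leaves the identity on A times the
        squared norm of \<Phi>.\<close>
      have "(\<Sum>\<xi>\<in>X. Q \<xi> i j) = (\<Sum>\<xi>\<in>X. \<Sum>k<b. \<Sum>m<a. \<Sum>m'<a.
          (\<epsilon> \<xi> (i, m) * cnj (\<epsilon> \<xi> (j, m'))) * (cnj (\<Phi> m k) * \<Phi> m' k))"
        unfolding Q_def steer_gram_def steer_def cnj_sum sum_product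
        by (intro sum.cong refl) (simp add: mult_ac)
      also have "\<dots> = (\<Sum>k<b. \<Sum>m<a. \<Sum>m'<a. \<Sum>\<xi>\<in>X.
          (\<epsilon> \<xi> (i, m) * cnj (\<epsilon> \<xi> (j, m'))) * (cnj (\<Phi> m k) * \<Phi> m' k))"
        by (subst sum.swap, intro sum.cong refl, subst sum.swap, intro sum.cong refl, rule sum.swap)
      also have "\<dots> = (\<Sum>k<b. \<Sum>m<a. \<Sum>m'<a. (if (i, m) = (j, m') then 1 else 0) * (cnj (\<Phi> m k) * \<Phi> m' k))"
        unfolding sum_distrib_right[symmetric]
        by (intro sum.cong refl) (subst resolution, use ij in \<open>auto simp: P_def\<close>)
      also have "\<dots> = (\<Sum>k<b. \<Sum>m<a. \<Sum>m'<a. if m = m' then (if i = j then cnj (\<Phi> m k) * \<Phi> m k else 0) else 0)"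
        by (intro sum.cong) auto
      also have "\<dots> = (if i = j then (\<Sum>k<b. \<Sum>m<a. cnj (\<Phi> m k) * \<Phi> m k) else 0)"
        by simp
      also have "(\<Sum>k<b. \<Sum>m<a. cnj (\<Phi> m k) * \<Phi> m k) = of_real (\<Sum>m<a. \<Sum>k<b. (cmod (\<Phi> m k))\<^sup>2)"
        by (subst sum.swap) (simp add: cmod_sq mult.commute)
      finally show ?thesis using st by (simp add: is_state_def)
    qed
  qed
qed

section \<open>From a decomposition to a protocol\<close>

definition wrap :: "nat \<Rightarrow> nat \<Rightarrow> nat \<Rightarrow> nat" where
  "wrap d t x = (if t + x < d then t + x else t + x - d)"

lemma wrap_less: "t < d \<Longrightarrow> x < d \<Longrightarrow> wrap d t x < d"
  by (auto simp: wrap_def)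

lemma wrap_inj_left: "t < d \<Longrightarrow> t' < d \<Longrightarrow> wrap d t x = wrap d t' x \<longleftrightarrow> t = t'"
  by (auto simp: wrap_def split: if_splits)

lemma sum_wrap:
  assumes "t < d" "i < d"
  shows "(\<Sum>x<d. if i = wrap d t x then (c::complex) else 0) = c"
proof -
  \<comment> \<open>The difference i - t modulo d, the only shift that takes t to i.\<close>
  define y where "y = (if t \<le> i then i - t else i + d - t)"
  have "i = wrap d t x \<longleftrightarrow> x = y" if "x < d" for x
    using assms that by (auto simp: wrap_def y_def)
  then have "(\<Sum>x<d. if i = wrap d t x then c else 0) = (\<Sum>x<d. if x = y then c else 0)"
    by (intro sum.cong) auto
  moreover have "y < d" using assms by (auto simp: y_def)
  ultimately show ?thesis by simp
qed

text \<open>Orthogonality of the characters of the cyclic group: a geometric sum whose ratio q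
  satisfies \<open>q ^ d = 1\<close>, with \<open>q = 1\<close> only for
  \<open>t = t'\<close>.\<close>

lemma sum_root_powers:
  assumes "t < d" "t' < d"
  shows "(\<Sum>z<d. cis (2 * pi * real t / real d) ^ z * cnj (cis (2 * pi * real t' / real d) ^ z))
    = (if t = t' then of_nat d else 0)"
proof -
  define \<omega> where "\<omega> = (\<lambda>k. cis (2 * pi * real k / real d))"
  have bij: "bij_betw \<omega> {..<d} {z. z ^ d = 1}"
    unfolding \<omega>_def using assms by (intro bij_betw_roots_unity) auto
  have root: "\<omega> k ^ d = 1" if "k < d" for k
    using bij_betwE[OF bij] that by simp
  have unit: "\<omega> k * cnj (\<omega> k) = 1" for k
    by (simp add: \<omega>_def cis_cnj cis_mult)
  define q where "q = \<omega> t * cnj (\<omega> t')"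
  have sum: "(\<Sum>z<d. \<omega> t ^ z * cnj (\<omega> t' ^ z)) = (\<Sum>z<d. q ^ z)"
    by (simp add: q_def power_mult_distrib)
  have "(\<Sum>z<d. \<omega> t ^ z * cnj (\<omega> t' ^ z)) = (if t = t' then of_nat d else 0)"
  proof (cases "t = t'")
    case True
    then show ?thesis using sum unit by (simp add: q_def)
  next
    case False
    have "q \<noteq> 1"
    proof
      assume "q = 1"
      then have "\<omega> t * (cnj (\<omega> t') * \<omega> t') = \<omega> t'" by (simp add: q_def flip: mult.assoc)
      then have "\<omega> t = \<omega> t'" using unit[of t'] by (simp add: mult.commute)
      then show False using False bij_betw_imp_inj_on[OF bij] assms by (auto dest: inj_onD)
    qed
    moreover have "q ^ d = 1"
      using root[OF assms(1)] root[OF assms(2)]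
      by (simp add: q_def power_mult_distrib flip: complex_cnj_power)
    ultimately show ?thesis
      using False sum by (simp add: geometric_sum)
  qed
  then show ?thesis unfolding \<omega>_def .
qed

section \<open>The shared state and the Bell vectors\<close>

definition max_entangled :: "nat \<Rightarrow> nat \<Rightarrow> nat \<Rightarrow> complex" where
  "max_entangled d i k = (if i = k then 1 / of_real (sqrt (real d)) else 0)"

lemma of_real_sqrt_square: "complex_of_real (sqrt (real d)) * complex_of_real (sqrt (real d)) = of_nat d"
  by (simp flip: of_real_mult)

lemma max_entangled_is_state:
  assumes "0 < d" shows "is_state d d (max_entangled d)"
proof -
  have "(cmod (max_entangled d i k))\<^sup>2 = (if i = k then 1 / real d else 0)" for i k
    by (simp add: max_entangled_def norm_divide power_divide)
  then show ?thesis using assms by (simp add: is_state_def)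
qed

lemma max_entangled_schmidt:
  assumes "0 < d" shows "schmidt_decomp d d (max_entangled d) d"
proof -
  define \<delta> :: "nat \<Rightarrow> nat \<Rightarrow> complex" where "\<delta> = (\<lambda>t i. if i = t then 1 else 0)"
  have "cinner d (\<delta> t) (\<delta> s) = (if t = s then 1 else 0)" if "t < d" for t s
  proof -
    have "cinner d (\<delta> t) (\<delta> s) = (\<Sum>i<d. if i = t then (if t = s then 1 else 0) else 0)"
      unfolding cinner_def by (intro sum.cong) (auto simp: \<delta>_def)
    then show ?thesis using that by simp
  qed
  moreover have "max_entangled d i k = (\<Sum>t<d. complex_of_real (1 / sqrt (real d)) * \<delta> t i * \<delta> t k)"
    if "i < d" for i k
  proof -
    have "(\<Sum>t<d. complex_of_real (1 / sqrt (real d)) * \<delta> t i * \<delta> t k)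
        = (\<Sum>t<d. if t = i then max_entangled d i k else 0)"
      by (intro sum.cong) (auto simp: \<delta>_def max_entangled_def)
    then show ?thesis using that by simp
  qed
  moreover have "\<delta> t \<in> vecs d" if "t < d" for t using that by (simp add: \<delta>_def vecs_def)
  ultimately show ?thesis
    unfolding schmidt_decomp_def using assms
    by - (rule exI[of _ "\<lambda>_. 1 / sqrt (real d)"], rule exI[of _ \<delta>], rule exI[of _ \<delta>], simp)
qed

lemma steer_max_entangled:
  assumes "k < d"
  shows "steer d e (max_entangled d) i k = cnj (e (i, k)) / of_real (sqrt (real d))"
  using assms
  by (simp add: steer_def max_entangled_def if_distrib[of "\<lambda>c. _ * c"] cong: if_cong)

text \<open>Teleportation measurement for a subspace with basis \<open>m 0, \<dots>, m (n - 1)\<close> and \<open>n \<le> d\<close>: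
  generalised Bell vectors with shift \<open>x\<close> and phase index \<open>z\<close>.\<close>

definition bell :: "nat \<Rightarrow> nat \<Rightarrow> (nat \<Rightarrow> nat \<Rightarrow> complex) \<Rightarrow> nat \<Rightarrow> nat \<Rightarrow> nat \<times> nat \<Rightarrow> complex" where
  "bell d n m x z p = (\<Sum>t<n. cis (2 * pi * real t / real d) ^ z * m t (fst p)
      * (if snd p = wrap d t x then 1 else 0)) / of_real (sqrt (real d))"

lemma bell_product:
  "bell d n m x z p * cnj (bell d n m x z q)
    = (\<Sum>t<n. \<Sum>t'<n. (cis (2 * pi * real t / real d) ^ z * cnj (cis (2 * pi * real t' / real d) ^ z))
        * (m t (fst p) * cnj (m t' (fst q))
            * (if snd p = wrap d t x \<and> snd q = wrap d t' x then 1 else 0))) / of_nat d"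
proof -
  have "bell d n m x z p * cnj (bell d n m x z q)
    = (\<Sum>t<n. cis (2 * pi * real t / real d) ^ z * m t (fst p) * (if snd p = wrap d t x then 1 else 0))
      * (\<Sum>t<n. cnj (cis (2 * pi * real t / real d) ^ z * m t (fst q) * (if snd q = wrap d t x then 1 else 0)))
      / of_nat d"
    by (simp add: bell_def cnj_sum of_real_sqrt_square)
  also have "\<dots> = (\<Sum>t<n. \<Sum>t'<n. (cis (2 * pi * real t / real d) ^ z * cnj (cis (2 * pi * real t' / real d) ^ z))
        * (m t (fst p) * cnj (m t' (fst q))
            * (if snd p = wrap d t x \<and> snd q = wrap d t' x then 1 else 0))) / of_nat d"
    unfolding sum_product by (intro arg_cong2[of _ _ _ _ "(/)"] sum.cong refl) auto
  finally show ?thesis .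
qed

text \<open>Summing over phases removes the cross terms \<open>t \<noteq> t'\<close> and yields a
  factor d that cancels the normalisation; summing over shifts then gives the identity on A'. For
  orthonormal m the result is the projection onto their span tensored with that identity.\<close>

lemma bell_sum:
  assumes n: "n \<le> d" and d: "0 < d" and q: "snd q < d"
  shows "(\<Sum>x<d. \<Sum>z<d. bell d n m x z p * cnj (bell d n m x z q))
    = (if snd p = snd q then \<Sum>t<n. m t (fst p) * cnj (m t (fst q)) else 0)"
proof -
  define \<omega> where "\<omega> = (\<lambda>k. cis (2 * pi * real k / real d))"
  define C where "C = (\<lambda>x t t'. m t (fst p) * cnj (m t' (fst q))
            * (if snd p = wrap d t x \<and> snd q = wrap d t' x then 1 else 0))"
  have "(\<Sum>x<d. \<Sum>z<d. bell d n m x z p * cnj (bell d n m x z q))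
     = (\<Sum>x<d. \<Sum>z<d. \<Sum>t<n. \<Sum>t'<n. (\<omega> t ^ z * cnj (\<omega> t' ^ z)) * C x t t') / of_nat d"
    unfolding bell_product \<omega>_def C_def sum_divide_distrib ..
  also have "(\<Sum>x<d. \<Sum>z<d. \<Sum>t<n. \<Sum>t'<n. (\<omega> t ^ z * cnj (\<omega> t' ^ z)) * C x t t')
     = (\<Sum>x<d. \<Sum>t<n. \<Sum>t'<n. \<Sum>z<d. (\<omega> t ^ z * cnj (\<omega> t' ^ z)) * C x t t')"
  proof (rule sum.cong[OF refl])
    fix x
    have "(\<Sum>z<d. \<Sum>t<n. \<Sum>t'<n. (\<omega> t ^ z * cnj (\<omega> t' ^ z)) * C x t t')
       = (\<Sum>t<n. \<Sum>z<d. \<Sum>t'<n. (\<omega> t ^ z * cnj (\<omega> t' ^ z)) * C x t t')" by (rule sum.swap)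
    also have "\<dots> = (\<Sum>t<n. \<Sum>t'<n. \<Sum>z<d. (\<omega> t ^ z * cnj (\<omega> t' ^ z)) * C x t t')"
      by (intro sum.cong refl sum.swap)
    finally show "(\<Sum>z<d. \<Sum>t<n. \<Sum>t'<n. (\<omega> t ^ z * cnj (\<omega> t' ^ z)) * C x t t')
       = (\<Sum>t<n. \<Sum>t'<n. \<Sum>z<d. (\<omega> t ^ z * cnj (\<omega> t' ^ z)) * C x t t')" .
  qed
  also have "\<dots> = (\<Sum>x<d. \<Sum>t<n. \<Sum>t'<n. (if t' = t then of_nat d * C x t t else 0))"
    unfolding sum_distrib_right[symmetric] \<omega>_def
    by (intro sum.cong refl, subst sum_root_powers) (use n in auto)
  also have "\<dots> = of_nat d * (\<Sum>x<d. \<Sum>t<n. C x t t)"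
    by (simp add: sum_distrib_left)
  also have "(\<Sum>x<d. \<Sum>t<n. C x t t) = (\<Sum>t<n. \<Sum>x<d. C x t t)"
    by (rule sum.swap)
  also have "\<dots> = (\<Sum>t<n. \<Sum>x<d. if snd q = wrap d t x then
      (if snd p = snd q then m t (fst p) * cnj (m t (fst q)) else 0) else 0)"
    by (intro sum.cong refl) (auto simp: C_def)
  also have "\<dots> = (\<Sum>t<n. if snd p = snd q then m t (fst p) * cnj (m t (fst q)) else 0)"
    by (intro sum.cong refl sum_wrap) (use n q in auto)
  finally show ?thesis using d by simp
qed

text \<open>For fixed x, distinct t are shifted to distinct positions, so cross terms vanish, and
  the phases on the diagonal have modulus one. One factor 1/d comes from the Bell vectors, the other
  from the shared state.\<close>

lemma bell_steer_gram:
  assumes n: "n \<le> d" and d: "0 < d" and x: "x < d"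
  shows "steer_gram d d (bell d n m x z) (max_entangled d) i j
    = (\<Sum>t<n. m t i * cnj (m t j)) / (of_nat d * of_nat d)"
proof -
  define \<omega> where "\<omega> = (\<lambda>k. cis (2 * pi * real k / real d))"
  have unit: "\<omega> k ^ z * cnj (\<omega> k ^ z) = 1" for k
    by (simp add: \<omega>_def Complex.DeMoivre cis_cnj cis_mult)
  have "steer_gram d d (bell d n m x z) (max_entangled d) i j
     = (\<Sum>k<d. bell d n m x z (i, k) * cnj (bell d n m x z (j, k)) / of_nat d)"
    unfolding steer_gram_def
    by (intro sum.cong refl) (simp add: steer_max_entangled of_real_sqrt_square)
  also have "\<dots> = (\<Sum>k<d. \<Sum>t<n. \<Sum>t'<n. (\<omega> t ^ z * cnj (\<omega> t' ^ z)) * (m t i * cnj (m t' j)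
            * (if k = wrap d t x \<and> k = wrap d t' x then 1 else 0))) / (of_nat d * of_nat d)"
    unfolding bell_product \<omega>_def sum_divide_distrib by simp
  also have "(\<Sum>k<d. \<Sum>t<n. \<Sum>t'<n. (\<omega> t ^ z * cnj (\<omega> t' ^ z)) * (m t i * cnj (m t' j)
            * (if k = wrap d t x \<and> k = wrap d t' x then 1 else 0)))
     = (\<Sum>k<d. \<Sum>t<n. \<Sum>t'<n. if t' = t then (if k = wrap d t x then m t i * cnj (m t j) else 0) else 0)"
    by (intro sum.cong refl) (use n unit wrap_inj_left in auto)
  also have "\<dots> = (\<Sum>k<d. \<Sum>t<n. if k = wrap d t x then m t i * cnj (m t j) else 0)"
    by simp
  also have "\<dots> = (\<Sum>t<n. \<Sum>k<d. if k = wrap d t x then m t i * cnj (m t j) else 0)"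
    by (rule sum.swap)
  also have "\<dots> = (\<Sum>t<n. m t i * cnj (m t j))"
    by (intro sum.cong refl) (use n x wrap_less in simp)
  finally show ?thesis .
qed

lemma csubspace_vecs: "csubspace n (vecs n)"
  by (simp add: csubspace_def vecs_def)

lemma protocol_from_decomposition:
  assumes pos: "0 < dA" and on: "orthonormal_family dA dB N \<psi>"
    and M: "orth_decomp dA K M"
    and mem: "\<And>j. j < N \<Longrightarrow> \<exists>k<K. in_tensor_sub dA dB (M k) (\<psi> j)"
    and dim: "\<And>k. k < K \<Longrightarrow> cdim (M k) \<le> d"
  shows "0 < d" "one_way_locc_dist dA dB N \<psi> d d (max_entangled d)"
proof -
  have sub: "csubspace dA (M k)" if "k < K" for k
    using M that by (simp add: orth_decomp_def)
  have orth: "ip {..<dA} u v = 0" if "k < K" "l < K" "k \<noteq> l" "u \<in> M k" "v \<in> M l" for k l u v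
    using M that unfolding orth_decomp_def cinner_eq_ip by blast
  define G where "G = (\<lambda>k nm. fst nm \<le> cdim (M k) \<and> (\<forall>t<fst nm. snd nm t \<in> M k)
    \<and> (\<forall>v\<in>M k. \<forall>i<dA. v i = (\<Sum>t<fst nm. ip {..<dA} (snd nm t) v * snd nm t i)))"
  have "\<exists>nm. G k nm" if k: "k < K" for k
  proof -
    obtain n :: nat and m where "n \<le> cdim (M k)" "\<forall>t<n. m t \<in> M k"
      "\<forall>v\<in>M k. \<forall>i<dA. v i = (\<Sum>t<n. ip {..<dA} (m t) v * m t i)"
      using orthonormal_basis_exists[OF sub[OF k]] by blast
    then have "G k (n, m)" by (simp only: G_def fst_conv snd_conv simp_thms)
    then show ?thesis ..
  qed
  then have "\<forall>k\<in>{..<K}. \<exists>nm. G k nm" by simp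
  from bchoice[OF this] obtain nm where nm: "\<forall>k\<in>{..<K}. G k (nm k)" ..
  define n where "n = (\<lambda>k. fst (nm k))"
  define m where "m = (\<lambda>k. snd (nm k))"
  have G: "G k (nm k)" if "k < K" for k using nm that by simp
  have nd: "n k \<le> d" if "k < K" for k
    using G[OF that, unfolded G_def, THEN conjunct1] dim[OF that] by (simp add: n_def)
  have mM: "m k t \<in> M k" if "k < K" "t < n k" for k t
    using G[OF that(1), unfolded G_def, THEN conjunct2, THEN conjunct1] that(2)
    by (simp add: n_def m_def)
  have expand: "v i = (\<Sum>t<n k. ip {..<dA} (m k t) v * m k t i)" if "k < K" "v \<in> M k" "i < dA" for k v i
    unfolding n_def m_def
    by (rule mp[OF spec[OF bspec[OF G[OF that(1), unfolded G_def, THEN conjunct2, THEN conjunct2] that(2)]] that(3)])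

  \<comment> \<open>The orthogonal projection onto \<open>M k\<close>: by \<open>expand\<close> it
    fixes \<open>M k\<close>, and it annihilates every other summand.\<close>
  define Pr where "Pr = (\<lambda>k i j. \<Sum>t<n k. m k t i * cnj (m k t j))"
  have Pr_apply: "(\<Sum>j<dA. Pr k i j * y j) = (\<Sum>t<n k. ip {..<dA} (m k t) y * m k t i)" for k i y
  proof -
    have "(\<Sum>j<dA. Pr k i j * y j) = (\<Sum>j<dA. \<Sum>t<n k. cnj (m k t j) * y j * m k t i)"
      by (simp add: Pr_def sum_distrib_left mult_ac)
    also have "\<dots> = (\<Sum>t<n k. \<Sum>j<dA. cnj (m k t j) * y j * m k t i)" by (rule sum.swap)
    finally show ?thesis by (simp add: ip_def sum_distrib_right)
  qed
  have Pr_M: "(\<Sum>j<dA. Pr k i j * y j) = (if k = l then 1 else 0) * y i"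
    if "k < K" "l < K" "y \<in> M l" "i < dA" for k l y i
  proof (cases "k = l")
    case True
    then show ?thesis unfolding Pr_apply using expand[of l y i] that by simp
  next
    case False
    then have "ip {..<dA} (m k t) y = 0" if "t < n k" for t
      using orth[of k l "m k t" y] mM[of k t] that \<open>k < K\<close> \<open>l < K\<close> \<open>y \<in> M l\<close> by blast
    then show ?thesis unfolding Pr_apply using False by simp
  qed
  have resolution: "(\<Sum>k<K. Pr k i j) = (if i = j then 1 else 0)" if ij: "i < dA" "j < dA" for i j
  proof -
    define v :: "nat \<Rightarrow> complex" where "v = (\<lambda>i. if i = j then 1 else 0)"
    have "v \<in> vecs dA" using ij by (simp add: v_def vecs_def)
    then obtain u where u: "\<And>k. k < K \<Longrightarrow> u k \<in> M k" "\<And>i. v i = (\<Sum>k<K. u k i)"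
      using M unfolding orth_decomp_def by metis
    \<comment> \<open>Applied to the j-th standard basis vector, the projection picks out the
      component in \<open>M k\<close>; the components add up to that vector.\<close>
    have "Pr k i j = u k i" if k: "k < K" for k
    proof -
      have "Pr k i j = (\<Sum>j'<dA. Pr k i j' * v j')"
        using ij by (simp add: v_def if_distrib[of "\<lambda>c. _ * c"] cong: if_cong)
      also have "\<dots> = (\<Sum>j'<dA. \<Sum>l<K. Pr k i j' * u l j')"
        by (simp add: u(2) sum_distrib_left)
      also have "\<dots> = (\<Sum>l<K. \<Sum>j'<dA. Pr k i j' * u l j')" by (rule sum.swap)
      also have "\<dots> = (\<Sum>l<K. (if k = l then 1 else 0) * u l i)"
        by (intro sum.cong refl Pr_M) (use k u ij in auto)
      also have "\<dots> = (\<Sum>l<K. if l = k then u k i else 0)" by (intro sum.cong) auto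
      finally show ?thesis using k by simp
    qed
    then have "(\<Sum>k<K. Pr k i j) = v i" by (simp add: u(2))
    then show ?thesis by (simp add: v_def)
  qed
  have Pr_tensor: "(\<Sum>j<dA. Pr k i j * \<psi> l j c) = (if k = k' then 1 else 0) * \<psi> l i c"
    if tens: "in_tensor_sub dA dB (M k') (\<psi> l)" and "k < K" "k' < K" "i < dA" "c < dB" for k k' l i c
  proof -
    obtain r :: nat and x w where x: "\<And>t. t < r \<Longrightarrow> x t \<in> M k'"
      and eq: "\<And>i k. i < dA \<Longrightarrow> k < dB \<Longrightarrow> \<psi> l i k = (\<Sum>t<r. x t i * w t k)"
      using tens unfolding in_tensor_sub_def by metis
    have "(\<Sum>j<dA. Pr k i j * \<psi> l j c) = (\<Sum>j<dA. \<Sum>t<r. Pr k i j * x t j * w t c)"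
      using eq \<open>c < dB\<close> by (simp add: sum_distrib_left mult.assoc)
    also have "\<dots> = (\<Sum>t<r. (\<Sum>j<dA. Pr k i j * x t j) * w t c)"
      unfolding sum_distrib_right by (rule sum.swap)
    also have "\<dots> = (\<Sum>t<r. (if k = k' then 1 else 0) * x t i * w t c)"
      using Pr_M[of k k' _ i] x that by simp
    also have "\<dots> = (if k = k' then 1 else 0) * \<psi> l i c"
      using eq that by simp
    finally show ?thesis .
  qed
  have off: "(\<Sum>c<dB. sesq {..<dA} (Pr k) (\<lambda>i. \<psi> j i c) (\<lambda>i. \<psi> l i c)) = 0"
    if "k < K" "j < N" "l < N" "j \<noteq> l" for k j l
  proof -
    obtain k' where k': "k' < K" "in_tensor_sub dA dB (M k') (\<psi> l)" using mem \<open>l < N\<close> by blast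
    have "sesq {..<dA} (Pr k) (\<lambda>i. \<psi> j i c) (\<lambda>i. \<psi> l i c)
        = (if k = k' then 1 else 0) * ip {..<dA} (\<lambda>i. \<psi> j i c) (\<lambda>i. \<psi> l i c)" if "c < dB" for c
      by (rule sesq_right_eigen) (use Pr_tensor k' that \<open>k < K\<close> in simp)
    then have "(\<Sum>c<dB. sesq {..<dA} (Pr k) (\<lambda>i. \<psi> j i c) (\<lambda>i. \<psi> l i c))
        = (if k = k' then 1 else 0) * (\<Sum>c<dB. \<Sum>i<dA. cnj (\<psi> j i c) * \<psi> l i c)"
      by (simp add: ip_def)
    also have "(\<Sum>c<dB. \<Sum>i<dA. cnj (\<psi> j i c) * \<psi> l i c) = (\<Sum>i<dA. \<Sum>c<dB. cnj (\<psi> j i c) * \<psi> l i c)"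
      by (rule sum.swap)
    also have "\<dots> = 0" using on that by (simp add: orthonormal_family_def)
    finally show ?thesis by simp
  qed

  show d: "0 < d"
  proof (rule ccontr)
    assume "\<not> 0 < d"
    then have "Pr k 0 0 = 0" if "k < K" for k using nd[OF that] by (simp add: Pr_def)
    then show False using resolution[of 0 0] pos by simp
  qed

  define P where "P = {..<dA} \<times> {..<d}"
  define R where "R = {..<dB} \<times> {..<d}"
  \<comment> \<open>Alice's outcome consists of the subspace k, the shift x and the phase index
    z.\<close>
  define X where "X = {..<K} \<times> ({..<d} \<times> {..<d})"
  define e where "e = (\<lambda>(k, x, z). bell d (n k) (m k) x z)"
  define prod where "prod = (\<lambda>j i k i' k'. \<psi> j i k * max_entangled d i' k')"
  have e_resolution: "(\<Sum>\<xi>\<in>X. e \<xi> p * cnj (e \<xi> q)) = (if p = q then 1 else 0)" if "p \<in> P" "q \<in> P" for p q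
  proof -
    have "(\<Sum>\<xi>\<in>X. e \<xi> p * cnj (e \<xi> q))
        = (\<Sum>k<K. \<Sum>x<d. \<Sum>z<d. bell d (n k) (m k) x z p * cnj (bell d (n k) (m k) x z q))"
      unfolding X_def e_def sum.cartesian_product by (simp add: case_prod_beta)
    also have "\<dots> = (\<Sum>k<K. if snd p = snd q then Pr k (fst p) (fst q) else 0)"
      unfolding Pr_def by (intro sum.cong refl bell_sum) (use nd d that in \<open>auto simp: P_def\<close>)
    also have "\<dots> = (if snd p = snd q then \<Sum>k<K. Pr k (fst p) (fst q) else 0)" by simp
    also have "\<dots> = (if p = q then 1 else 0)"
      using that by (auto simp: P_def resolution split: if_splits)
    finally show ?thesis .
  qed
  have orthB: "ip R (bob_state P (e \<xi>) (prod j)) (bob_state P (e \<xi>) (prod l)) = 0"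
    if \<xi>: "\<xi> \<in> X" and jl: "j < N" "l < N" "j \<noteq> l" for \<xi> j l
  proof -
    obtain k x z where kxz: "\<xi> = (k, x, z)" "k < K" "x < d" using \<xi> by (auto simp: X_def)
    have "ip R (bob_state P (e \<xi>) (prod j)) (bob_state P (e \<xi>) (prod l))
        = (\<Sum>c<dB. sesq {..<dA} (\<lambda>i j. Pr k i j / (of_nat d * of_nat d)) (\<lambda>i. \<psi> j i c) (\<lambda>i. \<psi> l i c))"
      unfolding R_def P_def prod_def ip_bob_state
      by (intro sum.cong refl sesq_cong)
        (use kxz nd d in \<open>simp add: e_def Pr_def bell_steer_gram\<close>)
    also have "\<dots> = (\<Sum>c<dB. sesq {..<dA} (Pr k) (\<lambda>i. \<psi> j i c) (\<lambda>i. \<psi> l i c)) / (of_nat d * of_nat d)"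
      by (simp add: sesq_def sum_divide_distrib)
    finally show ?thesis using off kxz jl by simp
  qed

  have "\<forall>\<xi>\<in>X. \<exists>F. povm R (Suc N) F \<and> (\<forall>j<N. \<forall>y<Suc N. y \<noteq> j \<longrightarrow>
      sesq R (F y) (bob_state P (e \<xi>) (prod j)) (bob_state P (e \<xi>) (prod j)) = 0)"
    by (intro ballI orthogonal_measurement orthB) (simp_all add: R_def)
  from bchoice[OF this] obtain F where F: "\<And>\<xi>. \<xi> \<in> X \<Longrightarrow> povm R (Suc N) (F \<xi>)"
    "\<And>\<xi> j y. \<xi> \<in> X \<Longrightarrow> j < N \<Longrightarrow> y < Suc N \<Longrightarrow> y \<noteq> j \<Longrightarrow>
      sesq R (F \<xi> y) (bob_state P (e \<xi>) (prod j)) (bob_state P (e \<xi>) (prod j)) = 0"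
    by blast
  obtain h where h: "bij_betw h {..<card X} X"
    using ex_bij_betw_nat_finite[of X] by (auto simp: X_def atLeast0LessThan)
  have hX: "h x \<in> X" if "x < card X" for x using bij_betwE[OF h] that by blast
  define EA where "EA = (\<lambda>x p q. e (h x) p * cnj (e (h x) q))"
  have "povm P (card X) EA"
    unfolding povm_def
  proof (intro conjI allI impI ballI)
    fix p q assume "p \<in> P" "q \<in> P"
    then show "(\<Sum>x<card X. EA x p q) = (if p = q then 1 else 0)"
      using e_resolution sum.reindex_bij_betw[OF h, of "\<lambda>\<xi>. e \<xi> p * cnj (e \<xi> q)"]
      by (simp add: EA_def)
  qed (simp add: EA_def psd_rank_one)
  moreover have "outcome_prob dA dB d d (prod j) (EA x) (F (h x) y) = 0"
    if "j < N" "x < card X" "y < Suc N" "y \<noteq> j" for j x y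
  proof -
    have "outcome_prob dA dB d d (prod j) (EA x) (F (h x) y)
      = (\<Sum>s<(1::nat). sesq R (F (h x) y) (bob_state P (e (h x)) (prod j)) (bob_state P (e (h x)) (prod j)))"
      unfolding R_def P_def by (rule outcome_prob_rank_one_sum) (simp add: EA_def)
    then show ?thesis using F(2)[OF hX] that by simp
  qed
  \<comment> \<open>The guess is Bob's outcome y itself; the extra outcome N names no state and has
    probability zero on all of them.\<close>
  ultimately show "one_way_locc_dist dA dB N \<psi> d d (max_entangled d)"
    unfolding one_way_locc_dist_def P_def[symmetric] R_def[symmetric]
    using F(1)[OF hX]
    by - (rule exI[of _ "card X"], rule exI[of _ EA], rule exI[of _ "\<lambda>_. Suc N"],
        rule exI[of _ "\<lambda>x. F (h x)"], rule exI[of _ "\<lambda>_ y. y"], simp add: prod_def)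
qed

section \<open>Comparison of the two minima\<close>

theorem theorem5:
  fixes dA dB :: nat and \<psi> :: "nat \<Rightarrow> nat \<Rightarrow> nat \<Rightarrow> complex"
  assumes "0 < dA" and "0 < dB"
    and "orthonormal_family dA dB (dA * dB) \<psi>"
  shows "r_min dA dB (dA * dB) \<psi> = d_min dA dB (dA * dB) \<psi>"
proof -
  define N where "N = dA * dB"
  define AR where "AR = (\<lambda>r. \<exists>a b \<Phi>. is_state a b \<Phi> \<and>
       one_way_locc_dist dA dB N \<psi> a b \<Phi> \<and> schmidt_rank a b \<Phi> = r)"
  define AD where "AD = (\<lambda>d. \<exists>K M. orth_decomp dA K M \<and>
       (\<forall>j<N. \<exists>k<K. in_tensor_sub dA dB (M k) (\<psi> j)) \<and> Max (cdim ` M ` {..<K}) = d)"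
  have R_from_D: "\<exists>r\<le>d. AR r" if d: "AD d" for d
  proof -
    obtain K M where KM: "orth_decomp dA K M" "\<And>j. j < N \<Longrightarrow> \<exists>k<K. in_tensor_sub dA dB (M k) (\<psi> j)"
      "Max (cdim ` M ` {..<K}) = d" using d unfolding AD_def by blast
    have dim: "cdim (M k) \<le> d" if "k < K" for k
      using KM(3) that by (auto intro!: Max_ge)
    note protocol = protocol_from_decomposition[OF assms(1) assms(3)[folded N_def] KM(1,2) dim]
    \<comment> \<open>As \<open>schmidt_rank\<close> is a least number, one explicit decomposition
      with d terms gives an upper bound, and no more is required.\<close>
    have "schmidt_rank d d (max_entangled d) \<le> d"
      unfolding schmidt_rank_def by (rule Least_le) (rule max_entangled_schmidt[OF protocol(1)])
    moreover have "AR (schmidt_rank d d (max_entangled d))"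
      unfolding AR_def using max_entangled_is_state protocol by blast
    ultimately show ?thesis by blast
  qed
  have D_from_R: "\<exists>d\<le>r. AD d" if r: "AR r" for r
  proof -
    obtain a b \<Phi> where \<Phi>: "is_state a b \<Phi>" "one_way_locc_dist dA dB N \<psi> a b \<Phi>"
      "schmidt_rank a b \<Phi> = r" using r unfolding AR_def by blast
    have "schmidt_decomp a b \<Phi> r"
      using LeastI_ex[OF schmidt_decomp_exists] \<Phi>(3) unfolding schmidt_rank_def by blast
    then obtain K M where KM: "0 < K" "orth_decomp dA K M"
      "\<forall>j<N. \<exists>k<K. in_tensor_sub dA dB (M k) (\<psi> j)" "\<forall>k<K. cdim (M k) \<le> r"
      using decomposition_from_protocol[OF assms \<Phi>(1) \<Phi>(2)[unfolded N_def]]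
      unfolding N_def[symmetric] by blast
    \<comment> \<open>\<open>0 < K\<close> matters here: the \<open>Max\<close> of an empty set
      would be unspecified.\<close>
    have "Max (cdim ` M ` {..<K}) \<le> r"
      using KM(1,4) by (intro Max.boundedI) (auto simp: lessThan_empty_iff)
    then show ?thesis using KM unfolding AD_def by blast
  qed
  \<comment> \<open>The trivial decomposition into a single summand makes the least d genuine;
    through \<open>R_from_D\<close> it does the same for the least r.\<close>
  have "\<exists>d. AD d"
  proof -
    have "orth_decomp dA 1 (\<lambda>_. vecs dA)"
      unfolding orth_decomp_def using csubspace_vecs by auto
    moreover have "in_tensor_sub dA dB (vecs dA) (\<psi> j)" for j
      unfolding in_tensor_sub_def
      by (rule exI[of _ dB], rule exI[of _ "\<lambda>t i. if i < dA then \<psi> j i t else 0"],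
          rule exI[of _ "\<lambda>t k. if k = t then 1 else 0"])
        (simp add: vecs_def if_distrib[of "\<lambda>c. _ * c"] cong: if_cong)
    ultimately show ?thesis unfolding AD_def by blast
  qed
  then have AD: "AD (LEAST d. AD d)" by (rule LeastI_ex)
  with R_from_D obtain r where r: "r \<le> (LEAST d. AD d)" "AR r" by blast
  have "(LEAST r. AR r) \<le> (LEAST d. AD d)"
    using Least_le[of AR, OF r(2)] r(1) by simp
  moreover have "AR (LEAST r. AR r)" using r(2) by (rule LeastI)
  then obtain d where "d \<le> (LEAST r. AR r)" "AD d" using D_from_R by blast
  then have "(LEAST d. AD d) \<le> (LEAST r. AR r)" using Least_le[of AD] by (meson order_trans)
  ultimately show ?thesis unfolding r_min_def d_min_def AR_def AD_def N_def by simp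
qed

end
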